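(* There exist an integer $c$ and an algorithm that, given a graph $G$ with $n$ vertices and a positive integer $k$, runs in time $2^k\cdot n^{O(1)}$ and outputs a finite family $\mathcal{C}$ of binary strings, each of length $L$, together with integers $L$ and $d$, with the following properties: (1) If $G$ contains a clique on $k$ vertices, then there is a string $w\in\{0,1\}^L$ such that $\mathrm{Ham}(w,x)\le d$ for each $x\in\mathcal{C}$. (2) If $G$ does not contain a clique on $k$ vertices, then for each string $w\in\{0,1\}^L$ there is $x\in\mathcal{C}$ such that $\mathrm{Ham}(w,x)>\left(1+\frac{1}{ck}\right)\cdot d$.
   Context: For equal-length strings $x,y$, $\mathrm{Ham}(x,y)$ denotes the Hamming distance, i.e., the number of positions on which $x$ and $y$ differ. *)

theory Defs
  imports
    Complex_Main
    "HOL-Library.Log_Nat"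
    "HOL-Computational_Algebra.Polynomial"
begin

section \<open>Strings and graphs\<close>

text \<open>Only meaningful for strings of equal length.\<close>

definition Ham :: "'a list \<Rightarrow> 'a list \<Rightarrow> nat" where
  "Ham x y = card {i. i < length x \<and> x ! i \<noteq> y ! i}"

text \<open>Finite simple graphs on the vertex set \<open>{..<n}\<close>; an undirected edge \<open>uv\<close> is
  represented by the two pairs \<open>(u, v)\<close> and \<open>(v, u)\<close>.\<close>

definition simple_graph :: "nat \<Rightarrow> (nat \<times> nat) set \<Rightarrow> bool" where
  "simple_graph n E \<longleftrightarrow> E \<subseteq> {..<n} \<times> {..<n} \<and> sym E \<and> irrefl E"

definition has_clique :: "nat \<Rightarrow> (nat \<times> nat) set \<Rightarrow> nat \<Rightarrow> bool" where
  "has_clique n E k \<longleftrightarrow>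
     (\<exists>K \<subseteq> {..<n}. card K = k \<and> (\<forall>u\<in>K. \<forall>v\<in>K. u \<noteq> v \<longrightarrow> (u, v) \<in> E))"


section \<open>Algorithms and their running time\<close>

text \<open>
  Algorithms are programs of a structured random access machine: finitely many named registers
  and finitely many named arrays hold natural numbers of arbitrary size, and results are written
  sequentially to an output tape. Running time is the logarithmic cost measure of Aho, Hopcroft
  and Ullman: every operand, address and result is charged its bit length. Hence running times
  agree, up to a polynomial in the bit length of the numbers involved, with the number of bit
  operations, and large numbers cannot be used as a source of free parallelism.
\<close>

type_synonym vname = string

datatype binop = Add | Sub | Mul | Div | Mod | Less | Eq

datatype aexp = N nat | V vname | Arr vname aexp | Bin binop aexp aexp

datatype com =
    Skip
  | Assign vname aexp
  | Store vname aexp aexp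
  | Output aexp
  | Seq com com
  | Cond aexp com com
  | While aexp com

record state =
  reg :: "vname \<Rightarrow> nat"
  arr :: "vname \<Rightarrow> nat \<Rightarrow> nat"
  tape :: "nat list"

text \<open>Subtraction is truncated at \<open>0\<close>, and \<open>a div 0 = 0\<close>, \<open>a mod 0 = a\<close>.
  Truth values are \<open>0\<close> and \<open>1\<close>; a test succeeds iff its value is nonzero.\<close>

fun binop_val :: "binop \<Rightarrow> nat \<Rightarrow> nat \<Rightarrow> nat" where
  "binop_val Add a b = a + b"
| "binop_val Sub a b = a - b"
| "binop_val Mul a b = a * b"
| "binop_val Div a b = a div b"
| "binop_val Mod a b = a mod b"
| "binop_val Less a b = of_bool (a < b)"
| "binop_val Eq a b = of_bool (a = b)"

fun aval :: "aexp \<Rightarrow> state \<Rightarrow> nat" where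
  "aval (N c) s = c"
| "aval (V x) s = reg s x"
| "aval (Arr a e) s = arr s a (aval e s)"
| "aval (Bin f e1 e2) s = binop_val f (aval e1 s) (aval e2 s)"

text \<open>\<open>floorlog 2 v\<close> is the number of binary digits of \<open>v\<close>, with \<open>floorlog 2 0 = 0\<close>.\<close>

definition lcost :: "nat \<Rightarrow> nat" where
  "lcost v = Suc (floorlog 2 v)"

text \<open>Each node is charged for its own value, so operands and addresses are charged at the
  subexpressions that produce them.\<close>

fun acost :: "aexp \<Rightarrow> state \<Rightarrow> nat" where
  "acost (N c) s = lcost c"
| "acost (V x) s = lcost (reg s x)"
| "acost (Arr a e) s = acost e s + lcost (aval (Arr a e) s)"
| "acost (Bin f e1 e2) s = acost e1 s + acost e2 s + lcost (aval (Bin f e1 e2) s)"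

text \<open>\<open>exec c s t s'\<close>: started in state \<open>s\<close>, the program \<open>c\<close> halts in state \<open>s'\<close> after time \<open>t\<close>.\<close>

inductive exec :: "com \<Rightarrow> state \<Rightarrow> nat \<Rightarrow> state \<Rightarrow> bool" where
  Skip: "exec Skip s 1 s"
| Assign: "exec (Assign x e) s (1 + acost e s) (s\<lparr>reg := (reg s)(x := aval e s)\<rparr>)"
| Store: "exec (Store a i e) s (1 + acost i s + acost e s)
    (s\<lparr>arr := (arr s)(a := (arr s a)(aval i s := aval e s))\<rparr>)"
| Output: "exec (Output e) s (1 + acost e s) (s\<lparr>tape := tape s @ [aval e s]\<rparr>)"
| Seq: "exec c1 s t1 s1 \<Longrightarrow> exec c2 s1 t2 s2 \<Longrightarrow> exec (Seq c1 c2) s (t1 + t2) s2"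
| CondTrue: "aval e s \<noteq> 0 \<Longrightarrow> exec c1 s t s' \<Longrightarrow> exec (Cond e c1 c2) s (1 + acost e s + t) s'"
| CondFalse: "aval e s = 0 \<Longrightarrow> exec c2 s t s' \<Longrightarrow> exec (Cond e c1 c2) s (1 + acost e s + t) s'"
| WhileFalse: "aval e s = 0 \<Longrightarrow> exec (While e c) s (1 + acost e s) s"
| WhileTrue: "aval e s \<noteq> 0 \<Longrightarrow> exec c s t1 s1 \<Longrightarrow> exec (While e c) s1 t2 s2 \<Longrightarrow>
    exec (While e c) s (1 + acost e s + t1 + t2) s2"

inductive_cases SkipE: "exec Skip s t s'"
inductive_cases AssignE: "exec (Assign x e) s t s'"
inductive_cases StoreE: "exec (Store a i e) s t s'"
inductive_cases OutputE: "exec (Output e) s t s'"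
inductive_cases SeqE: "exec (Seq c1 c2) s t s'"
inductive_cases CondE: "exec (Cond e c1 c2) s t s'"
inductive_cases WhileE: "exec (While e c) s t s'"

lemma exec_deterministic:
  "exec c s t s' \<Longrightarrow> exec c s u s'' \<Longrightarrow> u = t \<and> s'' = s'"
proof (induction arbitrary: u s'' rule: exec.induct)
  case (Seq c1 s t1 s1 c2 t2 s2)
  from Seq.prems obtain u1 r u2 where
    "u = u1 + u2" "exec c1 s u1 r" "exec c2 r u2 s''" by (rule SeqE)
  with Seq.IH show ?case by metis
next
  case (CondTrue e s c1 t s' c2)
  from CondTrue.prems show ?case
  proof (rule CondE)
    fix u1
    assume "u = Suc (acost e s + u1)" "exec c1 s u1 s''"
    with CondTrue.IH show ?thesis by (metis plus_1_eq_Suc add_Suc)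
  qed (use CondTrue.hyps in simp_all)
next
  case (CondFalse e s c2 t s' c1)
  from CondFalse.prems show ?case
  proof (rule CondE)
    fix u1
    assume "u = Suc (acost e s + u1)" "exec c2 s u1 s''"
    with CondFalse.IH show ?thesis by (metis plus_1_eq_Suc add_Suc)
  qed (use CondFalse.hyps in simp_all)
next
  case (WhileFalse e s c)
  from WhileFalse.prems show ?case
    by (rule WhileE) (use WhileFalse.hyps in simp_all)
next
  case (WhileTrue e s c t1 s1 t2 s2)
  from WhileTrue.prems show ?case
  proof (rule WhileE)
    fix u1 r u2
    assume "u = Suc (acost e s + u1 + u2)" "exec c s u1 r" "exec (While e c) r u2 s''"
    with WhileTrue.IH show ?thesis by (metis plus_1_eq_Suc add_Suc)
  qed (use WhileTrue.hyps in simp_all)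
next
  case (Skip s)
  from Skip.prems show ?case by (rule SkipE) simp
next
  case (Assign x e s)
  from Assign.prems show ?case by (rule AssignE) simp
next
  case (Store a i e s)
  from Store.prems show ?case by (rule StoreE) simp
next
  case (Output e s)
  from Output.prems show ?case by (rule OutputE) simp
qed

text \<open>The input graph is given by its adjacency matrix, stored row by row; all memory that
  does not hold input is initially \<open>0\<close>.\<close>

definition input_state :: "nat \<Rightarrow> (nat \<times> nat) set \<Rightarrow> nat \<Rightarrow> state" where
  "input_state n E k =
     \<lparr>reg = (\<lambda>_. 0)(''n'' := n, ''k'' := k),
      arr = (\<lambda>_ _. 0)(''G'' := (\<lambda>p. of_bool (p < n * n \<and> (p div n, p mod n) \<in> E))),
      tape = []\<rparr>"

text \<open>The output tape lists \<open>L\<close>, \<open>d\<close>, the number of strings, and then all bits of all strings.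
  If all strings have length \<open>L\<close>, then it determines \<open>L\<close>, \<open>d\<close> and the list of strings.\<close>

definition output_tape :: "nat \<Rightarrow> nat \<Rightarrow> bool list list \<Rightarrow> nat list" where
  "output_tape L d xs = L # d # length xs # concat (map (map of_bool) xs)"

end

theory Submission
  imports Defs
begin

text \<open>
  Let \<open>n < 2 ^ m\<close> with \<open>m = O(log n)\<close>. A greedy search yields \<open>n\<close> balanced codewords of length
  \<open>16 m\<close> with pairwise distance at least \<open>2 m\<close>, and a candidate centre consists of \<open>k\<close> blocks
  of this length, meant to hold the codewords of the \<open>k\<close> vertices of a clique. As blocks are
  logarithmically short, all pairs \<open>(y, z)\<close> of block contents can be listed. For every pair of
  blocks \<open>i \<noteq> j\<close> and every \<open>(y, z)\<close> that is not within distance \<open>m\<close> of the codewords of an edge,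
  the family contains the strings whose blocks \<open>i\<close> and \<open>j\<close> are the complements of \<open>y\<close> and \<open>z\<close>
  and whose other blocks are constant, one string for each of the \<open>2 ^ k\<close> choices of constants.
  Balanced blocks are at distance \<open>8 m\<close> from either constant, so a clique gives a centre with all
  distances at most \<open>8 k m + 15 m\<close>. Conversely, if blocks \<open>i\<close> and \<open>j\<close> of a centre hold such a
  pair, then choosing in each other block the constant opposite to its majority bit gives a
  string at distance at least \<open>8 k m + 16 m\<close>; if no pair of blocks does, then the centre decodes
  to a clique.
\<close>

section \<open>Balanced codes by greedy search\<close>

text \<open>Words are coded as naturals so that the program can use them as array addresses; leading
  zeros always agree, so no length has to be recorded.\<close>

definition bdist :: "nat \<Rightarrow> nat \<Rightarrow> nat" where
  "bdist y z = card {b. bit y b \<noteq> bit z b}"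

lemma bit_nat_less: "y < 2 ^ l \<Longrightarrow> bit y b \<Longrightarrow> b < l" for y :: nat
  by (metis bit_take_bit_iff take_bit_nat_eq_self)

lemma finite_bit_neq: "finite {b. bit y b \<noteq> bit z b}" for y z :: nat
proof -
  have "{b. bit y b \<noteq> bit z b} \<subseteq> {..<y} \<union> {..<z}"
    using bit_nat_less[of y y] bit_nat_less[of z z] by auto
  then show ?thesis by (rule finite_subset) auto
qed

lemma bdist_below:
  assumes "y < 2 ^ l" "z < 2 ^ l"
  shows "bdist y z = card {b. b < l \<and> bit y b \<noteq> bit z b}"
  unfolding bdist_def using assms bit_nat_less by (intro arg_cong[where f=card]) blast

lemma bdist_le: "y < 2 ^ l \<Longrightarrow> z < 2 ^ l \<Longrightarrow> bdist y z \<le> l"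
  unfolding bdist_below using card_mono[of "{..<l}"] by (force intro: order_trans[OF card_mono[of "{..<l}"]])

lemma bdist_commute: "bdist y z = bdist z y"
  by (simp add: bdist_def eq_commute)

lemma bdist_triangle: "bdist x z \<le> bdist x y + bdist y z"
proof -
  have "{b. bit x b \<noteq> bit z b} \<subseteq> {b. bit x b \<noteq> bit y b} \<union> {b. bit y b \<noteq> bit z b}" by blast
  from card_mono[OF finite_UnI[OF finite_bit_neq finite_bit_neq] this] show ?thesis
    unfolding bdist_def using card_Un_le order_trans by blast
qed

text \<open>Splitting off the lowest bit shifts all other positions by \<open>Suc\<close>. This
  recursion drives both the ball count and the program's table of distances.\<close>

lemma bdist_rec: "bdist y z = bdist (y div 2) (z div 2) + of_bool (odd y \<noteq> odd z)"
proof -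
  have "{b. bit y b \<noteq> bit z b} =
      Suc ` {b. bit (y div 2) b \<noteq> bit (z div 2) b} \<union> (if odd y \<noteq> odd z then {0} else {})"
    (is "?L = ?R")
  proof (rule set_eqI)
    fix b show "b \<in> ?L \<longleftrightarrow> b \<in> ?R"
      by (cases b) (auto simp: bit_0 bit_Suc image_iff)
  qed
  moreover have "finite (Suc ` {b. bit (y div 2) b \<noteq> bit (z div 2) b})"
    by (rule finite_imageI[OF finite_bit_neq])
  ultimately have "card {b. bit y b \<noteq> bit z b} = card (Suc ` {b. bit (y div 2) b \<noteq> bit (z div 2) b})
      + card (if odd y \<noteq> odd z then {0} else {} :: nat set)"
    by (simp only:) (rule card_Un_disjoint, auto)
  then show ?thesis unfolding bdist_def by (simp add: card_image)
qed

section \<open>Volume of Hamming balls and the covering argument\<close>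

lemma sum_lessThan_double:
  "(\<Sum>z<2 * k. f z) = (\<Sum>z<k. f (2 * z) + f (Suc (2 * z)))"
  for f :: "nat \<Rightarrow> 'a::comm_monoid_add"
  by (induction k) (auto simp: add.assoc)

text \<open>Positions contribute independently: a factor 2 where the bits agree and 1 where they
  differ, hence 1 + 2 per position. The induction removes the lowest bit of both words.\<close>

lemma sum_bdist_weights: "y < 2 ^ l \<Longrightarrow> (\<Sum>z<2 ^ l. 2 ^ (l - bdist y z)) = (3 ^ l :: nat)"
proof (induction l arbitrary: y)
  case 0 then show ?case by (simp add: bdist_def)
next
  case (Suc l)
  have y: "y div 2 < 2 ^ l" using Suc.prems by auto
  have "2 ^ (Suc l - bdist y (2 * z)) + 2 ^ (Suc l - bdist y (Suc (2 * z)))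
      = 3 * (2 ^ (l - bdist (y div 2) z) :: nat)" if "z < 2 ^ l" for z
  proof -
    have "bdist (y div 2) z \<le> l" using bdist_le[OF y that] .
    then show ?thesis
      using bdist_rec[of y "2 * z"] bdist_rec[of y "Suc (2 * z)"]
      by (cases "odd y") (auto simp: Suc_diff_le)
  qed
  then show ?case
    by (simp add: sum_lessThan_double sum_distrib_left[symmetric] Suc.IH[OF y])
qed

text \<open>A weighted count: every word of the ball weighs at least
  \<open>2 ^ (7 * m) = 128 ^ m\<close>, while all words together weigh
  \<open>3 ^ (8 * m) = 6561 ^ m\<close>.\<close>

lemma ball_bound:
  assumes "y < 2 ^ (8 * m)"
  shows "card {z. z < 2 ^ (8 * m) \<and> bdist y z < m} * 128 ^ m \<le> 6561 ^ m"
proof -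
  let ?S = "{z. z < 2 ^ (8 * m) \<and> bdist y z < m}"
  have "card ?S * 128 ^ m = (\<Sum>z\<in>?S. 2 ^ (7 * m))"
    by (simp add: power_mult)
  also have "\<dots> \<le> (\<Sum>z\<in>?S. 2 ^ (8 * m - bdist y z))"
    by (intro sum_mono power_increasing) auto
  also have "\<dots> \<le> (\<Sum>z<2 ^ (8 * m). 2 ^ (8 * m - bdist y z))"
    by (intro sum_mono2) auto
  also have "\<dots> = 3 ^ (8 * m)" by (rule sum_bdist_weights[OF assms])
  also have "\<dots> = 6561 ^ m" by (simp add: power_mult)
  finally show ?thesis .
qed

text \<open>Union bound: fewer than \<open>2 ^ m\<close> balls cannot exhaust the
  \<open>2 ^ (8 * m)\<close> words, because 2 * 6561 is below 2 ^ 8 * 128 = 32768.\<close>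

lemma uncovered_exists:
  fixes u n m :: nat
  assumes "u < n" "n \<le> 2 ^ m" and a: "\<And>v. v < u \<Longrightarrow> a v < 2 ^ (8 * m)"
  shows "\<exists>z<2 ^ (8 * m). \<forall>v<u. m \<le> bdist (a v) z"
proof (rule ccontr)
  let ?S = "\<lambda>v. {z. z < 2 ^ (8 * m) \<and> bdist (a v) z < m}"
  assume "\<not> ?thesis"
  then have "{..<2 ^ (8 * m)} \<subseteq> (\<Union>v<u. ?S v)" by (auto simp: not_le)
  moreover have "finite (\<Union>v<u. ?S v)" by auto
  ultimately have "card {..<2 ^ (8 * m)::nat} \<le> card (\<Union>v<u. ?S v)" by (intro card_mono)
  then have "2 ^ (8 * m) \<le> card (\<Union>v<u. ?S v)" by simp
  also have "\<dots> \<le> (\<Sum>v<u. card (?S v))" by (rule card_UN_le) simp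
  finally have "2 ^ (8 * m) * 128 ^ m \<le> (\<Sum>v<u. card (?S v) * 128 ^ m)"
    by (simp add: sum_distrib_right[symmetric])
  also have "\<dots> \<le> (\<Sum>v<u. 6561 ^ m)" by (intro sum_mono ball_bound a) simp
  also have "\<dots> = u * 6561 ^ m" by simp
  also have "\<dots> < 2 ^ m * 6561 ^ m" using assms by simp
  also have "\<dots> \<le> 32768 ^ m" by (simp flip: power_mult_distrib add: power_mono)
  also have "\<dots> = 2 ^ (8 * m) * 128 ^ m" by (simp add: power_mult flip: power_mult_distrib)
  finally show False by simp
qed

text \<open>The concatenation of \<open>a\<close> and its complement, so that codewords are balanced.\<close>

definition dbl :: "nat \<Rightarrow> nat \<Rightarrow> nat" where
  "dbl l a = Suc a * (2 ^ l - 1)"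

text \<open>The high half is \<open>a\<close> and the low half is the all-ones number minus
  \<open>a\<close>, its bitwise complement. The product in the definition of \<open>dbl\<close> is
  the form that the program evaluates.\<close>

lemma dbl_eq: "a < 2 ^ l \<Longrightarrow> dbl l a = a * 2 ^ l + (2 ^ l - Suc a)"
  unfolding dbl_def by (simp add: algebra_simps)

lemma dbl_less: assumes "a < 2 ^ l" shows "dbl l a < 2 ^ (2 * l)"
proof -
  have "dbl l a \<le> 2 ^ l * (2 ^ l - 1)" unfolding dbl_def using assms by (intro mult_right_mono) auto
  also have "\<dots> < 2 ^ l * 2 ^ l" by simp
  finally show ?thesis by (simp add: mult_2 power_add)
qed

text \<open>Subtracting from the all-ones number never borrows, so each of the \<open>l\<close> bits
  is flipped on its own.\<close>

lemma bit_complement: "a < 2 ^ l \<Longrightarrow> bit (2 ^ l - Suc a) b \<longleftrightarrow> b < l \<and> \<not> bit a b"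
proof (induction l arbitrary: a b)
  case 0 then show ?case by simp
next
  case (Suc l)
  have half: "(2 ^ Suc l - Suc a) div 2 = 2 ^ l - Suc (a div 2)"
    using Suc.prems by simp
  have less: "a div 2 < 2 ^ l" using Suc.prems by auto
  show ?case
  proof (cases b)
    case 0
    have "odd (2 ^ Suc l - Suc a) \<longleftrightarrow> even a" using Suc.prems by (simp add: Suc_leI)
    then show ?thesis using 0 by (simp add: bit_0)
  next
    case (Suc b')
    have "bit (2 ^ Suc l - Suc a) (Suc b') = bit (2 ^ l - Suc (a div 2)) b'"
      by (simp only: bit_Suc half)
    also have "\<dots> \<longleftrightarrow> b' < l \<and> \<not> bit (a div 2) b'" by (rule Suc.IH[OF less])
    finally show ?thesis using Suc by (simp add: bit_Suc)
  qed
qed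

lemma bit_dbl:
  assumes "a < 2 ^ l"
  shows "bit (dbl l a) b \<longleftrightarrow> (if b < l then \<not> bit a b else bit a (b - l))"
proof -
  let ?r = "2 ^ l - Suc a"
  have "dbl l a = push_bit l a + ?r"
    using assms by (simp add: dbl_eq push_bit_eq_mult)
  also have "\<dots> = or (push_bit l a) ?r"
    by (rule disjunctive_add_eq_or) (auto simp: bit_eq_iff bit_simps bit_complement[OF assms])
  finally show ?thesis
    by (auto simp: bit_simps bit_complement[OF assms])
qed

text \<open>Positions \<open>b\<close> and \<open>b + l\<close> carry opposite bits, so exactly one
  of them differs from a given constant.\<close>

lemma bit_dbl_card:
  assumes "a < 2 ^ l"
  shows "card {b. b < 2 * l \<and> bit (dbl l a) b \<noteq> \<sigma>} = l"
proof -
  let ?A = "{b. b < l \<and> \<not> bit a b \<noteq> \<sigma>}" and ?B = "{b. b < l \<and> bit a b \<noteq> \<sigma>}"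
  have eq: "{b. b < 2 * l \<and> bit (dbl l a) b \<noteq> \<sigma>} = ?A \<union> (\<lambda>b. b + l) ` ?B" (is "?L = ?R")
  proof (rule set_eqI)
    fix b show "b \<in> ?L \<longleftrightarrow> b \<in> ?R"
      by (cases "b < l") (auto simp: bit_dbl[OF assms] image_iff intro!: exI[of _ "b - l"])
  qed
  have "card ?L = card ?A + card ?B"
    unfolding eq by (subst card_Un_disjoint) (auto simp: card_image inj_on_def)
  also have "\<dots> = card (?A \<union> ?B)" by (subst card_Un_disjoint) auto
  also have "?A \<union> ?B = {..<l}" by auto
  finally show ?thesis by simp
qed

lemma bdist_dbl:
  assumes "a < 2 ^ l" "a' < 2 ^ l"
  shows "bdist (dbl l a) (dbl l a') = 2 * bdist a a'"
proof -
  let ?B = "{b. b < l \<and> bit a b \<noteq> bit a' b}"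
  have eq: "{b. b < 2 * l \<and> bit (dbl l a) b \<noteq> bit (dbl l a') b} = ?B \<union> (\<lambda>b. b + l) ` ?B" (is "?L = ?R")
  proof (rule set_eqI)
    fix b show "b \<in> ?L \<longleftrightarrow> b \<in> ?R"
      by (cases "b < l") (auto simp: bit_dbl assms image_iff intro!: exI[of _ "b - l"])
  qed
  have "card ?L = card ?B + card ?B"
    unfolding eq by (subst card_Un_disjoint) (auto simp: card_image inj_on_def)
  then show ?thesis
    by (simp add: bdist_below[OF dbl_less[OF assms(1)] dbl_less[OF assms(2)]] bdist_below[OF assms])
qed

section \<open>The gap\<close>

text \<open>The strict radius \<open>m\<close> is half the code distance \<open>2 * m\<close>, so
  for a code each block decodes to at most one vertex.\<close>

definition compat :: "(nat \<times> nat) set \<Rightarrow> nat \<Rightarrow> (nat \<Rightarrow> nat) \<Rightarrow> nat \<Rightarrow> nat \<Rightarrow> bool" where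
  "compat E m c y z \<longleftrightarrow> (\<exists>(u, v)\<in>E. bdist y (c u) < m \<and> bdist z (c v) < m)"

text \<open>Demanding doubled words is how balance is expressed: each codeword is then at distance
  exactly \<open>8 * m\<close> from both constant blocks.\<close>

definition is_code :: "nat \<Rightarrow> nat \<Rightarrow> (nat \<Rightarrow> nat) \<Rightarrow> bool" where
  "is_code n m c \<longleftrightarrow> (\<forall>u<n. c u \<in> dbl (8 * m) ` {..<2 ^ (8 * m)}) \<and>
     (\<forall>u<n. \<forall>v<n. u \<noteq> v \<longrightarrow> 2 * m \<le> bdist (c u) (c v))"

text \<open>Parameters with \<open>i = j\<close> or a compatible pair are not skipped but give
  blockwise constant strings. The number of strings thus has a closed form, known before the output
  starts, and these strings are at distance exactly \<open>8 * k * m\<close> from a sequence of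
  \<open>k\<close> codewords.\<close>

definition test_bit where
  "test_bit E m c i j y z s t b \<longleftrightarrow>
     (if i \<noteq> j \<and> \<not> compat E m c y z \<and> t = i then \<not> bit y b
      else if i \<noteq> j \<and> \<not> compat E m c y z \<and> t = j then \<not> bit z b
      else bit s t)" for s :: nat

lemma test_bit_const:
  "i = j \<or> compat E m c y z \<Longrightarrow> test_bit E m c i j y z s t b \<longleftrightarrow> bit s t"
  "t \<noteq> i \<Longrightarrow> t \<noteq> j \<Longrightarrow> test_bit E m c i j y z s t b \<longleftrightarrow> bit s t"
  unfolding test_bit_def by auto

lemma test_bit_special:
  assumes "i \<noteq> j" "\<not> compat E m c y z"
  shows "test_bit E m c i j y z s i b \<longleftrightarrow> \<not> bit y b"
    and "test_bit E m c i j y z s j b \<longleftrightarrow> \<not> bit z b"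
  using assms unfolding test_bit_def by auto

definition test_string where
  "test_string E k m c i j y z s =
     map (\<lambda>p. test_bit E m c i j y z s (p div (16 * m)) (p mod (16 * m))) [0..<k * (16 * m)]"

section \<open>Hamming distance computed block by block\<close>

lemma card_lessThan_conv_sum: "card {b. b < B \<and> P b} = (\<Sum>b<B. of_bool (P b))" for B :: nat
proof -
  have "{b. b < B \<and> P b} = {..<B} \<inter> {b. P b}" by auto
  then show ?thesis by simp
qed

lemma Ham_map_blocks:
  assumes "length w = k * B"
  shows "Ham w (map (\<lambda>p. f (p div B) (p mod B)) [0..<k * B]) =
    (\<Sum>t<k. card {b. b < B \<and> w ! (t * B + b) \<noteq> f t b})"
proof -
  let ?x = "map (\<lambda>p. f (p div B) (p mod B)) [0..<k * B]"
  have "Ham w ?x = (\<Sum>p<k * B. of_bool (w ! p \<noteq> ?x ! p))"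
    unfolding Ham_def assms by (rule card_lessThan_conv_sum)
  also have "\<dots> = (\<Sum>p<k * B. of_bool (w ! p \<noteq> f (p div B) (p mod B)))"
    by (intro sum.cong) auto
  also have "\<dots> = (\<Sum>t<k. \<Sum>p=t * B..<t * B + B. of_bool (w ! p \<noteq> f (p div B) (p mod B)))"
    by (rule sum.nat_group[symmetric])
  also have "\<dots> = (\<Sum>t<k. \<Sum>b<B. of_bool (w ! (t * B + b) \<noteq> f t b))"
  proof (rule sum.cong[OF refl])
    fix t
    have "(\<Sum>p=t * B..<t * B + B. of_bool (w ! p \<noteq> f (p div B) (p mod B)) :: nat) =
        (\<Sum>b<B. of_bool (w ! (t * B + b) \<noteq> f ((t * B + b) div B) ((t * B + b) mod B)))"
      by (subst sum.atLeastLessThan_shift_0) (simp add: atLeast0LessThan)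
    also have "\<dots> = (\<Sum>b<B. of_bool (w ! (t * B + b) \<noteq> f t b))"
      by (intro sum.cong) auto
    finally show "(\<Sum>p=t * B..<t * B + B. of_bool (w ! p \<noteq> f (p div B) (p mod B)) :: nat) =
      (\<Sum>b<B. of_bool (w ! (t * B + b) \<noteq> f t b))" .
  qed
  finally show ?thesis by (simp only: card_lessThan_conv_sum)
qed

lemma card_block_complement:
  fixes B :: nat
  shows "card {b. b < B \<and> P b \<noteq> (\<not> Q b)} = B - card {b. b < B \<and> P b \<noteq> Q b}"
proof -
  have "{b. b < B \<and> P b \<noteq> (\<not> Q b)} = {..<B} - {b. b < B \<and> P b \<noteq> Q b}" by auto
  then show ?thesis by (simp add: card_Diff_subset subset_iff)
qed

lemma sum_lessThan_two:
  fixes f :: "nat \<Rightarrow> nat"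
  assumes "i < k" "j < k" "i \<noteq> j"
  shows "sum f {..<k} = f i + f j + sum f ({..<k} - {i, j})"
proof -
  have "sum f {..<k} = sum f ({..<k} - {i, j}) + sum f {i, j}"
    by (rule sum.subset_diff) (use assms in auto)
  then show ?thesis using assms by simp
qed

section \<open>Completeness and soundness of the family\<close>

lemma is_codeE:
  assumes "is_code n m c" "u < n"
  obtains a where "a < 2 ^ (8 * m)" "c u = dbl (8 * m) a"
  using assms unfolding is_code_def by auto

lemma code_less: "is_code n m c \<Longrightarrow> u < n \<Longrightarrow> c u < 2 ^ (16 * m)"
  by (erule (1) is_codeE) (use dbl_less[of _ "8 * m"] in simp)

lemma code_balanced:
  assumes "is_code n m c" "u < n"
  shows "card {b. b < 16 * m \<and> bit (c u) b \<noteq> \<sigma>} = 8 * m"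
  using assms by (rule is_codeE) (use bit_dbl_card[of _ "8 * m"] in simp)

text \<open>The centre lists the codewords of the clique. Each constant block costs
  \<open>8 * m\<close>. The two special blocks would cost \<open>32 * m\<close>, but they belong to
  adjacent vertices and \<open>(y, z)\<close> is incompatible with every edge, so one of them is at
  distance at least \<open>m\<close> from its codeword, which saves \<open>m\<close>.\<close>

lemma completeness:
  assumes code: "is_code n m c" and clique: "has_clique n E k"
  shows "\<exists>w. length w = k * (16 * m) \<and>
    (\<forall>i<k. \<forall>j<k. \<forall>y<2 ^ (16 * m). \<forall>z<2 ^ (16 * m). \<forall>s.
      Ham w (test_string E k m c i j y z s) \<le> 8 * k * m + 15 * m)"
proof -
  let ?B = "16 * m"
  obtain K where K: "K \<subseteq> {..<n}" "card K = k" "\<And>u v. u \<in> K \<Longrightarrow> v \<in> K \<Longrightarrow> u \<noteq> v \<Longrightarrow> (u, v) \<in> E"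
    using clique unfolding has_clique_def by blast
  have "finite K" using K(1) finite_subset by blast
  then obtain f where f: "bij_betw f {..<k} K"
    using K(2) ex_bij_betw_nat_finite[of K] by (auto simp: atLeast0LessThan)
  have fK: "f t \<in> K" if "t < k" for t using f that by (auto simp: bij_betw_def)
  have fn: "f t < n" if "t < k" for t using fK[OF that] K(1) by auto
  define w where "w = map (\<lambda>p. bit (c (f (p div ?B))) (p mod ?B)) [0..<k * ?B]"
  have len: "length w = k * ?B" by (simp add: w_def)
  have wb: "w ! (t * ?B + b) = bit (c (f t)) b" if "t < k" "b < ?B" for t b
  proof -
    have "t * ?B + b < Suc t * ?B" using that by simp
    also have "\<dots> \<le> k * ?B" using that by (intro mult_right_mono) auto
    finally show ?thesis using that by (simp add: w_def)
  qed
  have "Ham w (test_string E k m c i j y z s) \<le> 8 * k * m + 15 * m"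
    if ij: "i < k" "j < k" and yz: "y < 2 ^ ?B" "z < 2 ^ ?B" for i j y z s
  proof -
    let ?g = "\<lambda>t. card {b. b < ?B \<and> bit (c (f t)) b \<noteq> test_bit E m c i j y z s t b}"
    have Ham: "Ham w (test_string E k m c i j y z s) = sum ?g {..<k}"
      unfolding test_string_def Ham_map_blocks[OF len]
      by (intro sum.cong refl arg_cong[where f = card]) (auto simp: wb)
    show ?thesis
    proof (cases "i \<noteq> j \<and> \<not> compat E m c y z")
      case False
      have "?g t = 8 * m" if "t < k" for t
        using code_balanced[OF code fn[OF that], of "bit s t"] False by (simp add: test_bit_const(1))
      then have "sum ?g {..<k} = k * (8 * m)" by simp
      then show ?thesis using Ham by simp
    next
      case True
      have rest: "?g t = 8 * m" if "t \<in> {..<k} - {i, j}" for t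
        using code_balanced[OF code fn[of t], of "bit s t"] that by (simp add: test_bit_const(2))
      have "?g i = ?B - bdist y (c (f i))"
        using True card_block_complement[of ?B "\<lambda>b. bit (c (f i)) b" "\<lambda>b. bit y b"]
          bdist_below[OF code_less[OF code fn[OF ij(1)]] yz(1)] bdist_commute
        by (simp add: test_bit_special)
      moreover have "?g j = ?B - bdist z (c (f j))"
        using True card_block_complement[of ?B "\<lambda>b. bit (c (f j)) b" "\<lambda>b. bit z b"]
          bdist_below[OF code_less[OF code fn[OF ij(2)]] yz(2)] bdist_commute
        by (simp add: test_bit_special)
      moreover have "(f i, f j) \<in> E"
        using f ij True K(3)[OF fK fK] by (auto simp: bij_betw_def inj_on_def)
      then have "m \<le> bdist y (c (f i)) \<or> m \<le> bdist z (c (f j))"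
        using True unfolding compat_def by force
      ultimately have "?g i + ?g j \<le> 31 * m" by auto
      moreover have "sum ?g {..<k} = ?g i + ?g j + sum ?g ({..<k} - {i, j})"
        using sum_lessThan_two[OF ij] True by blast
      moreover have "sum ?g ({..<k} - {i, j}) = (\<Sum>t\<in>{..<k} - {i, j}. 8 * m)"
        by (intro sum.cong refl rest)
      moreover have "card ({..<k} - {i, j}) = k - 2"
        using ij True by (subst card_Diff_subset) auto
      \<comment> \<open>Writing \<open>k\<close> as \<open>2 + k'\<close> removes the truncated
        subtraction in \<open>k - 2\<close>.\<close>
      moreover obtain k' where "k = 2 + k'"
        using ij True le_Suc_ex[of 2 k] by fastforce
      ultimately show ?thesis using Ham by (simp add: algebra_simps)
    qed
  qed
  with len show ?thesis by blast
qed

text \<open>A centre this close must have compatible blocks throughout, so every block decodes to a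
  unique vertex and distinct blocks decode to adjacent vertices.\<close>

lemma soundness:
  assumes code: "is_code n m c" and graph: "simple_graph n E" and "0 < k" "k \<le> n"
    and len: "length w = k * (16 * m)"
    and close: "\<And>i j y z s. i < k \<Longrightarrow> j < k \<Longrightarrow> y < 2 ^ (16 * m) \<Longrightarrow> z < 2 ^ (16 * m) \<Longrightarrow> s < 2 ^ k \<Longrightarrow>
      Ham w (test_string E k m c i j y z s) < 8 * k * m + 16 * m"
  shows "has_clique n E k"
proof (cases "k = 1")
  case True
  \<comment> \<open>A single block offers no second block to decode with, but any vertex is then a
    clique.\<close>
  then have "{0} \<subseteq> {..<n}" using \<open>k \<le> n\<close> by auto
  then show ?thesis unfolding has_clique_def using True by (intro exI[of _ "{0}"]) auto
next
  case False
  let ?B = "16 * m"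
  \<comment> \<open>Block \<open>t\<close> of the centre read as a number, first position lowest, so
    that it can be used as the parameter \<open>y\<close> or \<open>z\<close>.\<close>
  define wt where "wt t = horner_sum of_bool (2::nat) (map (\<lambda>b. w ! (t * ?B + b)) [0..<?B])" for t
  have wbit: "bit (wt t) b \<longleftrightarrow> b < ?B \<and> w ! (t * ?B + b)" for t b
    unfolding wt_def by (auto simp: bit_horner_sum_bit_iff)
  have wless: "wt t < 2 ^ ?B" for t
    unfolding wt_def using horner_sum_of_bool_2_less[of "map (\<lambda>b. w ! (t * ?B + b)) [0..<?B]"]
    by simp
  \<comment> \<open>\<open>maj t\<close> holds iff at least half of block \<open>t\<close> is False,
    so as a constant it is the bit opposite to the majority and disagrees with at least
    \<open>8 * m\<close> positions.\<close>
  define maj where "maj t \<longleftrightarrow> card {b. b < ?B \<and> bit (wt t) b \<noteq> True} \<ge> 8 * m" for t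
  define s where "s = horner_sum of_bool (2::nat) (map maj [0..<k])"
  have sbit: "bit s t \<longleftrightarrow> t < k \<and> maj t" for t
    unfolding s_def by (auto simp: bit_horner_sum_bit_iff)
  have sless: "s < 2 ^ k" using horner_sum_of_bool_2_less[of "map maj [0..<k]"] by (simp add: s_def)
  have half: "8 * m \<le> card {b. b < ?B \<and> bit (wt t) b \<noteq> maj t}" for t
  proof (cases "maj t")
    case True then show ?thesis by (simp add: maj_def)
  next
    case False
    then show ?thesis using card_block_complement[of ?B "bit (wt t)" "\<lambda>_. True"]
      by (simp add: maj_def)
  qed
  have pair: "compat E m c (wt i) (wt j)" if ij: "i < k" "j < k" "i \<noteq> j" for i j
  proof (rule ccontr)
    assume bad: "\<not> compat E m c (wt i) (wt j)"
    let ?g = "\<lambda>t. card {b. b < ?B \<and> bit (wt t) b \<noteq> test_bit E m c i j (wt i) (wt j) s t b}"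
    have "Ham w (test_string E k m c i j (wt i) (wt j) s) = sum ?g {..<k}"
      unfolding test_string_def Ham_map_blocks[OF len]
      by (intro sum.cong refl arg_cong[where f = card]) (auto simp: wbit)
    also have "\<dots> = ?g i + ?g j + sum ?g ({..<k} - {i, j})"
      by (rule sum_lessThan_two[OF ij])
    \<comment> \<open>The special blocks are the exact complements of the centre's own blocks and
      disagree everywhere, contributing \<open>32 * m\<close> instead of
      \<open>16 * m\<close>.\<close>
    also have "?g i = ?B" using bad ij by (simp add: test_bit_special)
    also have "?g j = ?B" using bad ij by (simp add: test_bit_special)
    finally have H: "Ham w (test_string E k m c i j (wt i) (wt j) s) = ?B + ?B + sum ?g ({..<k} - {i, j})" .
    have "(\<Sum>t\<in>{..<k} - {i, j}. 8 * m) \<le> sum ?g ({..<k} - {i, j})"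
      by (intro sum_mono) (use half in \<open>auto simp: test_bit_const(2) sbit\<close>)
    moreover have "card ({..<k} - {i, j}) = k - 2"
      using ij by (subst card_Diff_subset) auto
    moreover obtain k' where "k = 2 + k'"
      using ij le_Suc_ex[of 2 k] by fastforce
    ultimately have "8 * k * m + 16 * m \<le> Ham w (test_string E k m c i j (wt i) (wt j) s)"
      using H by (simp add: algebra_simps)
    with close[OF ij(1,2) wless wless sless, of i j] show False by simp
  qed
  have dec: "\<exists>u<n. bdist (wt i) (c u) < m" if "i < k" for i
  proof -
    obtain j where "j < k" "j \<noteq> i" using False \<open>0 < k\<close> that
      by (metis One_nat_def less_one linorder_neqE_nat not_less_eq)
    then have "compat E m c (wt i) (wt j)" using pair that by auto
    then obtain u v where "(u, v) \<in> E" "bdist (wt i) (c u) < m"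
      unfolding compat_def by auto
    then show ?thesis using graph unfolding simple_graph_def by auto
  qed
  then obtain f where f: "\<And>i. i < k \<Longrightarrow> f i < n \<and> bdist (wt i) (c (f i)) < m" by metis
  \<comment> \<open>Two codewords within distance less than \<open>m\<close> of the same block would
    be at distance less than \<open>2 * m\<close>.\<close>
  have uniq: "u = f i" if "u < n" "bdist (wt i) (c u) < m" "i < k" for u i
  proof (rule ccontr)
    assume "u \<noteq> f i"
    then have "2 * m \<le> bdist (c u) (c (f i))" using code f that unfolding is_code_def by blast
    also have "\<dots> \<le> bdist (c u) (wt i) + bdist (wt i) (c (f i))" by (rule bdist_triangle)
    finally show False using that f[OF that(3)] bdist_commute[of "c u" "wt i"] by simp
  qed
  have edge: "(f i, f j) \<in> E" if ij: "i < k" "j < k" "i \<noteq> j" for i j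
  proof -
    obtain u v where "(u, v) \<in> E" "bdist (wt i) (c u) < m" "bdist (wt j) (c v) < m"
      using pair[OF ij] unfolding compat_def by blast
    moreover from this have "u < n" "v < n" using graph unfolding simple_graph_def by auto
    ultimately show ?thesis using uniq[of u i] uniq[of v j] ij by simp
  qed
  \<comment> \<open>Distinct indices are mapped to the ends of an edge, and irreflexivity forbids
    these to coincide.\<close>
  have "inj_on f {..<k}"
    using edge graph unfolding inj_on_def simple_graph_def irrefl_def by (metis lessThan_iff)
  then have "card (f ` {..<k}) = k" by (simp add: card_image)
  then show ?thesis unfolding has_clique_def
    by (intro exI[of _ "f ` {..<k}"]) (use f edge in auto)
qed

section \<open>Enumeration of the family by a single index\<close>

definition test_strings where
  "test_strings E k m c = map (\<lambda>X. let q = X div 2 ^ k mod (2 ^ (16 * m) * 2 ^ (16 * m));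
      e = X div 2 ^ k div (2 ^ (16 * m) * 2 ^ (16 * m))
    in test_string E k m c (e div k) (e mod k) (q div 2 ^ (16 * m)) (q mod 2 ^ (16 * m)) (X mod 2 ^ k))
    [0..<k * k * (2 ^ (16 * m) * 2 ^ (16 * m)) * 2 ^ k]"

lemma mult_add_less_mult: "a < A \<Longrightarrow> b < B \<Longrightarrow> a * B + b < A * B" for a b :: nat
proof -
  assume "a < A" "b < B"
  then have "a * B + b < Suc a * B" by simp
  also have "\<dots> \<le> A * B" using \<open>a < A\<close> by (intro mult_right_mono) auto
  finally show ?thesis .
qed

text \<open>The index \<open>X\<close> is a mixed-radix number with digits \<open>i\<close>,
  \<open>j\<close>, \<open>y\<close>, \<open>z\<close>, \<open>s\<close> from highest to lowest, and
  every choice of digits occurs.\<close>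

lemma set_test_strings:
  "set (test_strings E k m c) = {test_string E k m c i j y z s | i j y z s.
     i < k \<and> j < k \<and> y < 2 ^ (16 * m) \<and> z < 2 ^ (16 * m) \<and> s < 2 ^ k}" (is "?L = ?R")
proof
  define M :: nat where "M = 2 ^ (16 * m)"
  have [simp]: "M > 0" by (simp add: M_def)
  show "?L \<subseteq> ?R"
  proof
    fix x assume "x \<in> ?L"
    then obtain X where X: "X < k * k * (M * M) * 2 ^ k" and x: "x = (let q = X div 2 ^ k mod (M * M); e = X div 2 ^ k div (M * M)
      in test_string E k m c (e div k) (e mod k) (q div M) (q mod M) (X mod 2 ^ k))"
      unfolding test_strings_def M_def by auto
    have "X div 2 ^ k div (M * M) < k * k"
      using X by (simp add: less_mult_imp_div_less)
    moreover from this have "k > 0" by (cases k) auto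
    moreover have "X div 2 ^ k mod (M * M) < M * M" by simp
    ultimately show "x \<in> ?R" unfolding x Let_def M_def[symmetric]
      by (intro CollectI exI conjI) (rule refl, simp_all add: less_mult_imp_div_less)
  qed
  show "?R \<subseteq> ?L"
  proof
    fix x assume "x \<in> ?R"
    then obtain i j y z s where *: "i < k" "j < k" "y < M" "z < M" "s < 2 ^ k"
      and x: "x = test_string E k m c i j y z s" unfolding M_def by blast
    let ?X = "((i * k + j) * (M * M) + (y * M + z)) * 2 ^ k + s"
    have yz: "y * M + z < M * M" by (rule mult_add_less_mult[OF *(3,4)])
    have "?X < k * k * (M * M) * 2 ^ k"
      by (intro mult_add_less_mult * )
    moreover have "?X div 2 ^ k = (i * k + j) * (M * M) + (y * M + z)" "?X mod 2 ^ k = s"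
      using * by auto
    moreover have "((i * k + j) * (M * M) + (y * M + z)) div (M * M) = i * k + j"
      "((i * k + j) * (M * M) + (y * M + z)) mod (M * M) = y * M + z"
      using yz by auto
    moreover have "(i * k + j) div k = i" "(i * k + j) mod k = j"
      "(y * M + z) div M = y" "(y * M + z) mod M = z" using * by auto
    ultimately show "x \<in> ?L" unfolding x test_strings_def M_def[symmetric] set_map
      by (intro image_eqI[where x = ?X]) (use * in \<open>simp_all add: Let_def del: div_mult_self3 div_mult_self4\<close>)
  qed
qed

section \<open>Programs with time bounds\<close>

text \<open>The tape is left out because expressions cannot read it, so it never influences a cost
  except through the value being written.\<close>

definition bounded :: "nat \<Rightarrow> state \<Rightarrow> bool" where
  "bounded K s \<longleftrightarrow> (\<forall>x. reg s x \<le> K) \<and> (\<forall>a i. arr s a i \<le> K)"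

fun asize :: "aexp \<Rightarrow> nat" where
  "asize (N c) = 1"
| "asize (V x) = 1"
| "asize (Arr a e) = 1 + asize e"
| "asize (Bin f e1 e2) = 1 + asize e1 + asize e2"

fun consts_le :: "nat \<Rightarrow> aexp \<Rightarrow> bool" where
  "consts_le K (N c) \<longleftrightarrow> c \<le> K"
| "consts_le K (V x) \<longleftrightarrow> True"
| "consts_le K (Arr a e) \<longleftrightarrow> consts_le K e"
| "consts_le K (Bin f e1 e2) \<longleftrightarrow> consts_le K e1 \<and> consts_le K e2"

section \<open>Bit lengths and the cost of expressions\<close>

lemma lcost_mono: "v \<le> w \<Longrightarrow> lcost v \<le> lcost w"
  by (simp add: lcost_def floorlog_mono)

lemma floorlog_le: "v < 2 ^ l \<Longrightarrow> floorlog 2 v \<le> l"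
  by (rule floorlog_leI) simp_all

lemma less_power_floorlog: "v < 2 ^ floorlog 2 v"
  using floorlog_bounds[of v 2] by (cases "v = 0") auto

lemma lcost_add: "lcost (a + b) \<le> lcost a + lcost b"
proof -
  \<comment> \<open>The extra digit for a carry is paid for by the second \<open>Suc\<close> in
    \<open>lcost a + lcost b\<close>.\<close>
  have "a + b < 2 ^ (1 + floorlog 2 a + floorlog 2 b)"
  proof -
    have "a < 2 ^ (floorlog 2 a + floorlog 2 b)"
      by (rule less_le_trans[OF less_power_floorlog]) (simp add: power_increasing)
    moreover have "b < 2 ^ (floorlog 2 a + floorlog 2 b)"
      by (rule less_le_trans[OF less_power_floorlog]) (simp add: power_increasing)
    ultimately show ?thesis by simp
  qed
  from floorlog_le[OF this] show ?thesis by (simp add: lcost_def)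
qed

lemma lcost_mult: "lcost (a * b) \<le> lcost a + lcost b"
proof -
  have "a * b < 2 ^ (floorlog 2 a + floorlog 2 b)"
    unfolding power_add by (intro mult_strict_mono less_power_floorlog) auto
  from floorlog_le[OF this] show ?thesis by (simp add: lcost_def)
qed

text \<open>No operation needs more than the digits of both operands and a carry; the single digit
  of a comparison is covered because each \<open>lcost\<close> is at least 1.\<close>

lemma lcost_binop: "lcost (binop_val f a b) \<le> lcost a + lcost b"
proof (cases f)
  case Add then show ?thesis by (simp add: lcost_add)
next
  case Mul then show ?thesis by (simp add: lcost_mult)
next
  case Sub
  then show ?thesis using lcost_mono[of "a - b" a] by simp
next
  case Div
  then show ?thesis using lcost_mono[of "a div b" a] by simp
next
  case Mod
  then show ?thesis using lcost_mono[of "a mod b" a] by simp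
next
  case Less then show ?thesis using floorlog_le[of "of_bool (a < b)" 1] by (auto simp: lcost_def of_bool_def split: if_splits)
next
  case Eq then show ?thesis using floorlog_le[of "of_bool (a = b)" 1] by (auto simp: lcost_def of_bool_def split: if_splits)
qed

lemma lcost_aval: "bounded K s \<Longrightarrow> consts_le K e \<Longrightarrow> lcost (aval e s) \<le> asize e * lcost K"
proof (induction e)
  case (Bin f e1 e2)
  then show ?case using lcost_binop[of f "aval e1 s" "aval e2 s"] by (simp add: algebra_simps)
next
  case (Arr a e)
  then show ?case using lcost_mono[of "arr s a (aval e s)" K] by (simp add: bounded_def)
qed (auto simp: bounded_def intro: lcost_mono)

text \<open>Quadratic in the size: each of the \<open>asize e\<close> nodes has a value of bit cost
  at most \<open>asize e * lcost K\<close>.\<close>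

lemma acost_le: "bounded K s \<Longrightarrow> consts_le K e \<Longrightarrow> acost e s \<le> asize e ^ 2 * lcost K"
proof (induction e)
  case (Bin f e1 e2)
  have "acost (Bin f e1 e2) s \<le> (asize e1 ^ 2 + asize e2 ^ 2 + asize (Bin f e1 e2)) * lcost K"
    using Bin lcost_aval[of K s "Bin f e1 e2"] by (simp add: algebra_simps)
  also have "\<dots> \<le> asize (Bin f e1 e2) ^ 2 * lcost K"
    by (intro mult_right_mono) (auto simp: power2_eq_square algebra_simps)
  finally show ?case .
next
  case (Arr a e)
  have "acost (Arr a e) s \<le> (asize e ^ 2 + 1) * lcost K"
    using Arr lcost_mono[of "arr s a (aval e s)" K] by (simp add: bounded_def)
  also have "\<dots> \<le> asize (Arr a e) ^ 2 * lcost K"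
    by (intro mult_right_mono) (auto simp: power2_eq_square)
  finally show ?case .
qed (auto simp: bounded_def intro: lcost_mono)

text \<open>A fixed size bound lets all evaluations share one cost unit; 1000 is a round number with
  room for the largest expression, \<open>bit_exp\<close>.\<close>

definition legal :: "nat \<Rightarrow> aexp \<Rightarrow> bool" where
  "legal K e \<longleftrightarrow> consts_le K e \<and> asize e \<le> 1000"

definition step_cost :: "nat \<Rightarrow> nat" where
  "step_cost K = 1 + 1000 ^ 2 * lcost K"

lemma acost_le_step: "bounded K s \<Longrightarrow> legal K e \<Longrightarrow> 1 + acost e s \<le> step_cost K"
proof -
  assume *: "bounded K s" "legal K e"
  then have "acost e s \<le> asize e ^ 2 * lcost K" by (auto simp: legal_def intro: acost_le)
  also have "\<dots> \<le> 1000 ^ 2 * lcost K"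
    using * by (intro mult_right_mono power_mono) (auto simp: legal_def)
  finally show ?thesis by (simp add: step_cost_def)
qed

text \<open>Time is counted in units of \<open>step_cost K\<close>, which pays for one evaluation of a legal
  expression as long as all memory cells stay below \<open>K\<close>.\<close>

definition hoare :: "nat \<Rightarrow> (state \<Rightarrow> bool) \<Rightarrow> com \<Rightarrow> nat \<Rightarrow> (state \<Rightarrow> bool) \<Rightarrow> bool" where
  "hoare K P c T Q \<longleftrightarrow> (\<forall>s. bounded K s \<and> P s \<longrightarrow>
     (\<exists>t s'. exec c s t s' \<and> t \<le> T * step_cost K \<and> bounded K s' \<and> Q s'))"

section \<open>Proof rules for Hoare triples with time bounds\<close>

lemma hoareI:
  assumes "\<And>s. bounded K s \<Longrightarrow> P s \<Longrightarrow>
    \<exists>t s'. exec c s t s' \<and> t \<le> T * step_cost K \<and> bounded K s' \<and> Q s'"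
  shows "hoare K P c T Q"
  using assms unfolding hoare_def by blast

lemma hoareE:
  assumes "hoare K P c T Q" "bounded K s" "P s"
  obtains t s' where "exec c s t s'" "t \<le> T * step_cost K" "bounded K s'" "Q s'"
  using assms unfolding hoare_def by blast

lemma hoare_skip:
  assumes "\<And>s. bounded K s \<Longrightarrow> P s \<Longrightarrow> Q s"
  shows "hoare K P Skip 1 Q"
  by (rule hoareI) (use exec.Skip assms in \<open>fastforce simp: step_cost_def\<close>)

lemma hoare_assign:
  assumes "legal K e"
    and "\<And>s. bounded K s \<Longrightarrow> P s \<Longrightarrow> aval e s \<le> K"
    and "\<And>s. bounded K s \<Longrightarrow> P s \<Longrightarrow> Q (s\<lparr>reg := (reg s)(x := aval e s)\<rparr>)"
  shows "hoare K P (Assign x e) 1 Q"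
proof (rule hoareI)
  fix s assume s: "bounded K s" "P s"
  show "\<exists>t s'. exec (Assign x e) s t s' \<and> t \<le> 1 * step_cost K \<and> bounded K s' \<and> Q s'"
    using exec.Assign[of x e s] acost_le_step[OF s(1) assms(1)] assms(2,3)[OF s] s(1)
    by (intro exI conjI) (assumption, auto simp: bounded_def)
qed

text \<open>\<open>Bin Add i e\<close> is not executed: its cost dominates the costs of
  \<open>i\<close> and \<open>e\<close> together, so a store takes one unit.\<close>

lemma hoare_store:
  assumes "legal K (Bin Add i e)"
    and "\<And>s. bounded K s \<Longrightarrow> P s \<Longrightarrow> aval e s \<le> K"
    and "\<And>s. bounded K s \<Longrightarrow> P s \<Longrightarrow> Q (s\<lparr>arr := (arr s)(a := (arr s a)(aval i s := aval e s))\<rparr>)"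
  shows "hoare K P (Store a i e) 1 Q"
proof (rule hoareI)
  fix s assume s: "bounded K s" "P s"
  show "\<exists>t s'. exec (Store a i e) s t s' \<and> t \<le> 1 * step_cost K \<and> bounded K s' \<and> Q s'"
    using exec.Store[of a i e s] acost_le_step[OF s(1) assms(1)] assms(2,3)[OF s] s(1)
    by (intro exI conjI) (assumption, auto simp: bounded_def)
qed

lemma hoare_output:
  assumes "legal K e"
    and "\<And>s. bounded K s \<Longrightarrow> P s \<Longrightarrow> Q (s\<lparr>tape := tape s @ [aval e s]\<rparr>)"
  shows "hoare K P (Output e) 1 Q"
proof (rule hoareI)
  fix s assume s: "bounded K s" "P s"
  show "\<exists>t s'. exec (Output e) s t s' \<and> t \<le> 1 * step_cost K \<and> bounded K s' \<and> Q s'"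
    using exec.Output[of e s] acost_le_step[OF s(1) assms(1)] assms(2)[OF s] s(1)
    by (intro exI conjI) (assumption, auto simp: bounded_def)
qed

lemma hoare_seq:
  assumes "hoare K P c1 T1 R" "hoare K R c2 T2 Q"
  shows "hoare K P (Seq c1 c2) (T1 + T2) Q"
proof (rule hoareI)
  fix s assume s: "bounded K s" "P s"
  obtain t1 s1 where 1: "exec c1 s t1 s1" "t1 \<le> T1 * step_cost K" "bounded K s1" "R s1"
    using assms(1) s by (rule hoareE)
  obtain t2 s2 where 2: "exec c2 s1 t2 s2" "t2 \<le> T2 * step_cost K" "bounded K s2" "Q s2"
    using assms(2) 1(3,4) by (rule hoareE)
  show "\<exists>t s'. exec (Seq c1 c2) s t s' \<and> t \<le> (T1 + T2) * step_cost K \<and> bounded K s' \<and> Q s'"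
    using exec.Seq[OF 1(1) 2(1)] 1 2
    by (intro exI conjI) (assumption, auto simp: algebra_simps)
qed

lemma hoare_cond:
  assumes "legal K e" "hoare K (\<lambda>s. P s \<and> aval e s \<noteq> 0) c1 T Q"
    "hoare K (\<lambda>s. P s \<and> aval e s = 0) c2 T Q"
  shows "hoare K P (Cond e c1 c2) (1 + T) Q"
proof (rule hoareI)
  fix s assume s: "bounded K s" "P s"
  show "\<exists>t s'. exec (Cond e c1 c2) s t s' \<and> t \<le> (1 + T) * step_cost K \<and> bounded K s' \<and> Q s'"
  proof (cases "aval e s = 0")
    case True
    then obtain t s' where "exec c2 s t s'" "t \<le> T * step_cost K" "bounded K s'" "Q s'"
      using hoareE[OF assms(3) s(1)] s(2) by blast
    then show ?thesis using exec.CondFalse[OF True] acost_le_step[OF s(1) assms(1)]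
      by (intro exI conjI) (assumption, auto)
  next
    case False
    then obtain t s' where "exec c1 s t s'" "t \<le> T * step_cost K" "bounded K s'" "Q s'"
      using hoareE[OF assms(2) s(1)] s(2) by blast
    then show ?thesis using exec.CondTrue[OF False] acost_le_step[OF s(1) assms(1)]
      by (intro exI conjI) (assumption, auto)
  qed
qed

lemma hoare_conseq:
  assumes "hoare K P c T Q" "\<And>s. P' s \<Longrightarrow> P s" "\<And>s. Q s \<Longrightarrow> Q' s"
  shows "hoare K P' c T Q'"
  using assms unfolding hoare_def by meson

definition For :: "vname \<Rightarrow> aexp \<Rightarrow> com \<Rightarrow> com" where
  "For x e c = Seq (Assign x (N 0))
     (While (Bin Less (V x) e) (Seq c (Assign x (Bin Add (V x) (N 1)))))"

text \<open>A round pays for the test, the body and the increment, hence \<open>T + 2\<close>; the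
  leading 2 pays for the initialisation and the last, failing test. The invariant must not depend on
  register \<open>x\<close>, so that the increment preserves it.\<close>

lemma hoare_for:
  assumes K: "B \<le> K" "1 \<le> K" and legal: "legal K (Bin Less (V x) e)"
    and inv: "\<And>i v s. I i s \<Longrightarrow> I i (s\<lparr>reg := (reg s)(x := v)\<rparr>)"
    and bound: "\<And>i s. I i s \<Longrightarrow> aval e s = B"
    and body: "\<And>i. i < B \<Longrightarrow>
      hoare K (\<lambda>s. I i s \<and> reg s x = i) c T (\<lambda>s. I (Suc i) s \<and> reg s x = i)"
  shows "hoare K (I 0) (For x e c) (2 + B * (T + 2)) (I B)"
proof -
  let ?b = "Bin Less (V x) e" and ?c = "Seq c (Assign x (Bin Add (V x) (N 1)))"
  \<comment> \<open>Induction on the number \<open>j\<close> of rounds still to go.\<close>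
  have loop: "\<exists>t s'. exec (While ?b ?c) s t s' \<and> t \<le> (1 + j * (T + 2)) * step_cost K \<and>
      bounded K s' \<and> I B s'"
    if "j \<le> B" "bounded K s" "I (B - j) s" "reg s x = B - j" for j s
    using that
  proof (induction j arbitrary: s)
    case 0
    then have "aval ?b s = 0" using bound by simp
    from exec.WhileFalse[OF this, of ?c] show ?case
      using 0 acost_le_step[OF 0(2) legal] by (intro exI conjI) (assumption, auto)
  next
    case (Suc j)
    let ?i = "B - Suc j"
    have i: "?i < B" and si: "Suc ?i = B - j" using Suc.prems by auto
    have "hoare K (\<lambda>s. I ?i s \<and> reg s x = ?i) ?c (T + 1)
        (\<lambda>s. I (Suc ?i) s \<and> reg s x = Suc ?i)"
    proof (rule hoare_seq[OF body[OF i] hoare_assign])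
      show "legal K (Bin Add (V x) (N 1))" using K by (simp add: legal_def)
    qed (use i K in \<open>auto intro: inv\<close>)
    then obtain t1 s1 where 1: "exec ?c s t1 s1" "t1 \<le> (T + 1) * step_cost K" "bounded K s1"
      "I (Suc ?i) s1 \<and> reg s1 x = Suc ?i"
      using Suc.prems by (elim hoareE[of K _ _ _ _ s]) auto
    then obtain t2 s2 where 2: "exec (While ?b ?c) s1 t2 s2" "t2 \<le> (1 + j * (T + 2)) * step_cost K"
      "bounded K s2" "I B s2"
      using Suc.IH[of s1] Suc.prems(1) unfolding si by auto
    have "aval ?b s \<noteq> 0" using bound[OF Suc.prems(3)] Suc.prems i by simp
    from exec.WhileTrue[OF this 1(1) 2(1)] show ?case
      using 1 2 acost_le_step[OF Suc.prems(2) legal]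
      by (intro exI conjI) (assumption, auto simp: algebra_simps)
  qed
  have "hoare K (I 0) (For x e c) (1 + (1 + B * (T + 2))) (I B)"
    unfolding For_def
  proof (rule hoare_seq)
    show "hoare K (I 0) (Assign x (N 0)) 1 (\<lambda>s. I 0 s \<and> reg s x = 0)"
      by (rule hoare_assign) (auto simp: legal_def intro: inv)
    show "hoare K (\<lambda>s. I 0 s \<and> reg s x = 0) (While ?b ?c) (1 + B * (T + 2)) (I B)"
      by (rule hoareI) (use loop[of B] in auto)
  qed
  then show ?thesis by simp
qed

section \<open>The reduction as a program\<close>

abbreviation add_exp (infixl "[+]" 65) where "a [+] b \<equiv> Bin Add a b"
abbreviation sub_exp (infixl "[-]" 65) where "a [-] b \<equiv> Bin Sub a b"
abbreviation mul_exp (infixl "[*]" 70) where "a [*] b \<equiv> Bin Mul a b"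
abbreviation div_exp (infixl "[div]" 70) where "a [div] b \<equiv> Bin Div a b"
abbreviation mod_exp (infixl "[mod]" 70) where "a [mod] b \<equiv> Bin Mod a b"
abbreviation less_exp (infix "[<]" 50) where "a [<] b \<equiv> Bin Less a b"
abbreviation eq_exp (infix "[=]" 50) where "a [=] b \<equiv> Bin Eq a b"
abbreviation seq_com (infixr ";;" 60) where "c1 ;; c2 \<equiv> Seq c1 c2"

text \<open>Array \<open>P\<close> holds the powers of two, \<open>D\<close> the distances of all pairs of blocks, \<open>C\<close> the code,
  \<open>H\<close> marks the candidates too close to an earlier codeword, and \<open>F\<close> marks the pairs of blocks
  close to the codewords of an edge.\<close>

definition powers_com :: com where
  "powers_com = Store ''P'' (N 0) (N 1) ;;
     For ''i'' (N 16 [*] V ''n'') (Store ''P'' (V ''i'' [+] N 1) (N 2 [*] Arr ''P'' (V ''i'')))"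

text \<open>The machine has no logarithm: \<open>m\<close> is found by counting the exponents
  \<open>i\<close> with \<open>2 ^ i\<close> at most \<open>n\<close>.\<close>

definition sizes_com :: com where
  "sizes_com =
     For ''i'' (V ''n'') (Assign ''m'' (V ''m'' [+] (Arr ''P'' (V ''i'') [<] V ''n'' [+] N 1))) ;;
     Assign ''Q'' (Arr ''P'' (N 8 [*] V ''m'')) ;;
     Assign ''M'' (Arr ''P'' (N 16 [*] V ''m'')) ;;
     Assign ''L'' (V ''k'' [*] (N 16 [*] V ''m''))"

text \<open>Dynamic programming along \<open>bdist_rec\<close>: the entry of \<open>(y, z)\<close>
  is that of \<open>(y div 2, z div 2)\<close> plus the comparison of the lowest bits. Subtraction
  from 1 negates a truth value.\<close>

definition distances_com :: com where
  "distances_com = For ''i'' (V ''M'' [*] V ''M'') (Store ''D'' (V ''i'')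
     (Arr ''D'' (V ''i'' [div] V ''M'' [div] N 2 [*] V ''M'' [+] V ''i'' [mod] V ''M'' [div] N 2) [+]
      (N 1 [-] (V ''i'' [div] V ''M'' [mod] N 2 [=] V ''i'' [mod] V ''M'' [mod] N 2))))"

definition dbl_exp :: aexp where
  "dbl_exp = (V ''i'' [+] N 1) [*] (V ''Q'' [-] N 1)"

text \<open>The first inner loop overwrites its choice and so ends with the last unmarked candidate;
  the second marks all candidates close to it. Positivity of a sum serves as disjunction.\<close>

definition code_com :: com where
  "code_com = For ''u'' (V ''n'')
     (For ''i'' (V ''Q'') (Cond (Arr ''H'' (V ''i'')) Skip (Store ''C'' (V ''u'') dbl_exp)) ;;
      For ''i'' (V ''Q'') (Store ''H'' (V ''i'') (N 0 [<] Arr ''H'' (V ''i'') [+]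
        (Arr ''D'' (Arr ''C'' (V ''u'') [*] V ''M'' [+] dbl_exp) [<] N 2 [*] V ''m''))))"

definition edge_exp :: aexp where
  "edge_exp = V ''i'' [div] (V ''M'' [*] V ''M'')"

definition pair_exp :: aexp where
  "pair_exp = V ''i'' [mod] (V ''M'' [*] V ''M'')"

text \<open>One counter runs through all combinations of a matrix position and a pair of block
  contents. Products act as conjunctions, and the disjunction over edges accumulates in
  \<open>F\<close>.\<close>

definition compat_com :: com where
  "compat_com = For ''i'' (V ''n'' [*] V ''n'' [*] (V ''M'' [*] V ''M''))
     (Store ''F'' pair_exp (N 0 [<] Arr ''F'' pair_exp [+] Arr ''G'' edge_exp [*]
       ((Arr ''D'' (pair_exp [div] V ''M'' [*] V ''M'' [+] Arr ''C'' (edge_exp [div] V ''n'')) [<] V ''m'') [*]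
        (Arr ''D'' (pair_exp [mod] V ''M'' [*] V ''M'' [+] Arr ''C'' (edge_exp [mod] V ''n'')) [<] V ''m''))))"

definition header_com :: com where
  "header_com = Output (V ''L'') ;;
     Output (N 8 [*] V ''k'' [*] V ''m'' [+] N 15 [*] V ''m'') ;;
     Output (V ''k'' [*] V ''k'' [*] (V ''M'' [*] V ''M'') [*] Arr ''P'' (V ''k''))"

definition block_exp :: aexp where
  "block_exp = V ''i'' [mod] V ''L'' [div] (N 16 [*] V ''m'')"

definition power_exp :: aexp where
  "power_exp = Arr ''P'' (V ''i'' [mod] V ''L'' [mod] (N 16 [*] V ''m''))"

definition code_pair_exp :: aexp where
  "code_pair_exp = V ''i'' [div] V ''L'' [div] Arr ''P'' (V ''k'') [mod] (V ''M'' [*] V ''M'')"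

definition index_pair_exp :: aexp where
  "index_pair_exp = V ''i'' [div] V ''L'' [div] Arr ''P'' (V ''k'') [div] (V ''M'' [*] V ''M'')"

definition active_exp :: aexp where
  "active_exp = (N 1 [-] (index_pair_exp [div] V ''k'' [=] index_pair_exp [mod] V ''k'')) [*]
     (N 1 [-] Arr ''F'' code_pair_exp)"

text \<open>Expressions have no conditional, so it is simulated arithmetically; \<open>b\<close> has
  to evaluate to 0 or 1.\<close>

definition if_exp :: "aexp \<Rightarrow> aexp \<Rightarrow> aexp \<Rightarrow> aexp" where
  "if_exp b e1 e2 = b [*] e1 [+] (N 1 [-] b) [*] e2"

definition bit_exp :: aexp where
  "bit_exp =
     if_exp (active_exp [*] (block_exp [=] index_pair_exp [div] V ''k''))
       (N 1 [-] code_pair_exp [div] V ''M'' [div] power_exp [mod] N 2)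
       (if_exp (active_exp [*] (block_exp [=] index_pair_exp [mod] V ''k''))
         (N 1 [-] code_pair_exp [mod] V ''M'' [div] power_exp [mod] N 2)
         (V ''i'' [div] V ''L'' [mod] Arr ''P'' (V ''k'') [div] Arr ''P'' block_exp [mod] N 2))"

definition bits_com :: com where
  "bits_com = For ''i''
     (V ''k'' [*] V ''k'' [*] (V ''M'' [*] V ''M'') [*] Arr ''P'' (V ''k'') [*] V ''L'') (Output bit_exp)"

definition reduction_com :: com where
  "reduction_com = powers_com ;; sizes_com ;; distances_com ;; code_com ;; compat_com ;; header_com ;; bits_com"

text \<open>The output for \<open>n < k\<close>, where no clique exists: length 1, radius 0 and the
  strings 0 and 1, which no centre can both match.\<close>

definition trivial_com :: com where
  "trivial_com = Output (N 1) ;; Output (N 0) ;; Output (N 2) ;; Output (N 0) ;; Output (N 1)"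

definition reduction :: com where
  "reduction = Cond (V ''n'' [<] V ''k'') trivial_com reduction_com"

lemma power_le_iff_less_floorlog: "2 ^ p \<le> n \<longleftrightarrow> p < floorlog 2 n" for n :: nat
proof
  assume "2 ^ p \<le> n"
  also have "n < 2 ^ floorlog 2 n" by (rule less_power_floorlog)
  finally show "p < floorlog 2 n" by simp
next
  assume p: "p < floorlog 2 n"
  then have "n \<noteq> 0" by (auto simp: floorlog_def split: if_splits)
  have "(2::nat) ^ p \<le> 2 ^ (floorlog 2 n - 1)" using p by (intro power_increasing) auto
  also have "\<dots> \<le> n" using floorlog_bounds[of n 2] \<open>n \<noteq> 0\<close> by simp
  finally show "2 ^ p \<le> n" .
qed

section \<open>Correctness of the single phases when \<open>k\<close> is at most
  \<open>n\<close>\<close>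

locale clique_instance =
  fixes n k :: nat and E :: "(nat \<times> nat) set"
  assumes graph: "simple_graph n E" and k_pos: "0 < k" and k_le: "k \<le> n"
begin

definition m :: nat where "m = floorlog 2 n"
definition M :: nat where "M = 2 ^ (16 * m)"
text \<open>The summands bound the table of powers, the counter of the loop filling \<open>F\<close>
  and the counter of the output loop; all other stored values lie below one of these.\<close>

definition K :: nat where
  "K = 2 ^ (16 * n) + n * n * (M * M) + k * k * (M * M) * 2 ^ k * (k * (16 * m))"

lemma n_pos: "0 < n" using k_pos k_le by simp

lemma m_pos: "0 < m"
  using power_le_iff_less_floorlog[of 0 n] n_pos by (simp add: m_def)

lemma m_le: "m \<le> n"
  unfolding m_def by (rule floorlog_le) simp

lemma n_less: "n < 2 ^ m"
  unfolding m_def by (rule less_power_floorlog)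

lemma M_pos: "0 < M" by (simp add: M_def)

lemma M_gt: "16 * m < M" by (simp add: M_def)

lemma power_le_K: "p \<le> 16 * n \<Longrightarrow> 2 ^ p \<le> K"
  unfolding K_def using power_increasing[of p "16 * n" "2::nat"] by linarith

lemma small_le_K: "v \<le> 65536 \<Longrightarrow> v \<le> K"
  using power_le_K[of 16] n_pos by simp

lemma M_le_K: "M \<le> K" unfolding M_def using m_le by (intro power_le_K) simp

lemma n_le_K: "n \<le> K"
  using power_le_K[of n] less_exp[of n] by linarith

definition input_inv :: "state \<Rightarrow> bool" where
  "input_inv s \<longleftrightarrow> reg s ''n'' = n \<and> reg s ''k'' = k \<and>
     arr s ''G'' = (\<lambda>p. of_bool (p < n * n \<and> (p div n, p mod n) \<in> E))"

definition powers_inv :: "state \<Rightarrow> bool" where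
  "powers_inv s \<longleftrightarrow> (\<forall>p\<le>16 * n. arr s ''P'' p = 2 ^ p)"

definition sizes_inv :: "state \<Rightarrow> bool" where
  "sizes_inv s \<longleftrightarrow> reg s ''m'' = m \<and> reg s ''Q'' = 2 ^ (8 * m) \<and> reg s ''M'' = M \<and>
     reg s ''L'' = k * (16 * m)"

definition distances_inv :: "state \<Rightarrow> bool" where
  "distances_inv s \<longleftrightarrow> (\<forall>q<M * M. arr s ''D'' q = bdist (q div M) (q mod M))"

definition zero :: "vname \<Rightarrow> state \<Rightarrow> bool" where
  "zero a s \<longleftrightarrow> arr s a = (\<lambda>_. 0)"

lemmas inv_defs = input_inv_def powers_inv_def sizes_inv_def distances_inv_def zero_def

lemma legal_simps [simp]:
  "legal K e \<longleftrightarrow> consts_le K e \<and> asize e \<le> 1000" by (rule legal_def)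

text \<open>As the machine cannot exponentiate, powers come from a table. Exponents up to
  \<open>16 * n\<close> suffice, because \<open>m\<close> and \<open>k\<close> are at most
  \<open>n\<close>.\<close>

lemma powers_correct:
  "hoare K
     (\<lambda>s. input_inv s \<and> tape s = [] \<and> reg s ''m'' = 0 \<and> zero ''D'' s \<and> zero ''H'' s \<and> zero ''F'' s)
     powers_com (1 + (2 + 16 * n * 3))
     (\<lambda>s. input_inv s \<and> tape s = [] \<and> reg s ''m'' = 0 \<and> zero ''D'' s \<and> zero ''H'' s \<and> zero ''F'' s
       \<and> powers_inv s)"
proof -
  let ?I = "\<lambda>i s. input_inv s \<and> tape s = [] \<and> reg s ''m'' = 0 \<and> zero ''D'' s \<and> zero ''H'' s \<and>
    zero ''F'' s \<and> (\<forall>p\<le>i. arr s ''P'' p = 2 ^ p)"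
  have "hoare K (?I 0) (For ''i'' (N 16 [*] V ''n'')
      (Store ''P'' (V ''i'' [+] N 1) (N 2 [*] Arr ''P'' (V ''i'')))) (2 + 16 * n * (1 + 2)) (?I (16 * n))"
  proof (rule hoare_for)
    show "16 * n \<le> K" using power_le_K[of "16 * n"] less_exp[of "16 * n"] by linarith
    fix i assume i: "i < 16 * n"
    have "2 ^ Suc i \<le> K" using i by (intro power_le_K) simp
    then show "hoare K (\<lambda>s. ?I i s \<and> reg s ''i'' = i) (Store ''P'' (V ''i'' [+] N 1) (N 2 [*] Arr ''P'' (V ''i'')))
      1 (\<lambda>s. ?I (Suc i) s \<and> reg s ''i'' = i)"
      by (intro hoare_store) (auto simp: inv_defs le_Suc_eq small_le_K)
  qed (auto simp: inv_defs small_le_K)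
  then show ?thesis unfolding powers_com_def
    by (intro hoare_seq[OF hoare_store[where Q = "?I 0"]])
      (auto simp: inv_defs small_le_K elim: hoare_conseq)
qed

lemma sizes_correct:
  "hoare K
     (\<lambda>s. input_inv s \<and> tape s = [] \<and> reg s ''m'' = 0 \<and> zero ''D'' s \<and> zero ''H'' s \<and> zero ''F'' s
       \<and> powers_inv s)
     sizes_com (2 + n * (1 + 2) + (1 + (1 + 1)))
     (\<lambda>s. input_inv s \<and> tape s = [] \<and> zero ''D'' s \<and> zero ''H'' s \<and> zero ''F'' s
       \<and> powers_inv s \<and> sizes_inv s)"
proof -
  let ?R = "\<lambda>s. input_inv s \<and> tape s = [] \<and> zero ''D'' s \<and> zero ''H'' s \<and> zero ''F'' s \<and> powers_inv s"
  \<comment> \<open>Round \<open>i\<close> adds 1 iff \<open>2 ^ i\<close> is at most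
    \<open>n\<close>, which happens iff \<open>i < m\<close>.\<close>
  let ?I = "\<lambda>i s. ?R s \<and> reg s ''m'' = min i m"
  have Q: "2 ^ (8 * m) \<le> K" using m_le by (intro power_le_K) simp
  have "1 * (k * (16 * m)) \<le> k * k * (M * M) * 2 ^ k * (k * (16 * m))"
    using k_pos M_pos by (intro mult_right_mono) (auto simp: Suc_le_eq)
  then have L: "k * (16 * m) \<le> K" unfolding K_def by linarith
  have "hoare K (?I 0) (For ''i'' (V ''n'')
      (Assign ''m'' (V ''m'' [+] (Arr ''P'' (V ''i'') [<] V ''n'' [+] N 1)))) (2 + n * (1 + 2)) (?I n)"
  proof (rule hoare_for)
    fix i assume i: "i < n"
    have "2 ^ i < Suc n \<longleftrightarrow> i < m"
      using power_le_iff_less_floorlog[of i n] by (simp add: m_def less_Suc_eq_le)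
    then show "hoare K (\<lambda>s. ?I i s \<and> reg s ''i'' = i)
        (Assign ''m'' (V ''m'' [+] (Arr ''P'' (V ''i'') [<] V ''n'' [+] N 1)))
        1 (\<lambda>s. ?I (Suc i) s \<and> reg s ''i'' = i)"
      using i m_le n_le_K by (intro hoare_assign) (auto simp: inv_defs small_le_K)
  qed (auto simp: inv_defs small_le_K n_le_K)
  moreover have "min n m = m" using m_le by simp
  ultimately have loop: "hoare K (\<lambda>s. ?R s \<and> reg s ''m'' = 0) (For ''i'' (V ''n'')
      (Assign ''m'' (V ''m'' [+] (Arr ''P'' (V ''i'') [<] V ''n'' [+] N 1)))) (2 + n * (1 + 2))
      (\<lambda>s. ?R s \<and> reg s ''m'' = m)"
    by simp
  show ?thesis unfolding sizes_com_def
    apply (rule hoare_seq[OF hoare_conseq[OF loop]])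
      apply simp
     apply assumption
    apply (rule hoare_seq[OF hoare_assign[where Q = "\<lambda>s. ?R s \<and> reg s ''m'' = m \<and> reg s ''Q'' = 2 ^ (8 * m)"]])
       apply (use m_le Q in \<open>auto simp: inv_defs small_le_K\<close>)[3]
    apply (rule hoare_seq[OF hoare_assign[where Q = "\<lambda>s. ?R s \<and> reg s ''m'' = m \<and> reg s ''Q'' = 2 ^ (8 * m) \<and> reg s ''M'' = M"]])
       apply (use m_le M_le_K in \<open>auto simp: inv_defs small_le_K M_def\<close>)[3]
    apply (rule hoare_assign)
      apply (use m_le L in \<open>auto simp: inv_defs small_le_K bounded_def\<close>)[3]
    done
qed

text \<open>Halving both components of a pair moves to a strictly smaller index, except at index 0;
  so the table can be filled in increasing order.\<close>

lemma div_div_mod_pair: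
  assumes "q < M * M"
  shows "q div M div 2 * M + q mod M div 2 \<le> q"
    and "(q div M div 2 * M + q mod M div 2) div M = q div M div 2"
    and "(q div M div 2 * M + q mod M div 2) mod M = q mod M div 2"
    and "q div M div 2 * M + q mod M div 2 = q \<Longrightarrow> q = 0"
proof -
  have "q div M div 2 * M \<le> q div M * M" by (intro mult_right_mono) auto
  moreover have q: "q div M * M + q mod M = q" by simp
  ultimately show "q div M div 2 * M + q mod M div 2 \<le> q" by linarith
  have less: "q mod M div 2 < M" using M_pos by (meson div_le_dividend le_less_trans mod_less_divisor)
  then show div: "(q div M div 2 * M + q mod M div 2) div M = q div M div 2"
    and mod: "(q div M div 2 * M + q mod M div 2) mod M = q mod M div 2" by auto
  assume eq: "q div M div 2 * M + q mod M div 2 = q"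
  have "q div M = q div M div 2" "q mod M = q mod M div 2"
    using div mod unfolding eq .
  then have "q div M = 0" "q mod M = 0" by linarith+
  with q show "q = 0" by simp
qed

lemma bdist_pair_le: "bdist (q div M) (q mod M) \<le> 16 * m" if "q < M * M"
  using that M_pos unfolding M_def by (intro bdist_le) (auto simp: less_mult_imp_div_less)

lemma MM_le_K: "M * M \<le> K"
proof -
  have "1 * (M * M) \<le> n * n * (M * M)" using n_pos by (intro mult_right_mono) (auto simp: Suc_le_eq)
  then show ?thesis unfolding K_def by linarith
qed

lemma m_le_K: "16 * m \<le> K" using M_gt M_le_K by simp

lemma distances_correct:
  "hoare K
     (\<lambda>s. input_inv s \<and> tape s = [] \<and> zero ''D'' s \<and> zero ''H'' s \<and> zero ''F'' s
       \<and> powers_inv s \<and> sizes_inv s)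
     distances_com (2 + M * M * (1 + 2))
     (\<lambda>s. input_inv s \<and> tape s = [] \<and> zero ''H'' s \<and> zero ''F'' s
       \<and> powers_inv s \<and> sizes_inv s \<and> distances_inv s)"
proof -
  let ?R = "\<lambda>s. input_inv s \<and> tape s = [] \<and> zero ''H'' s \<and> zero ''F'' s \<and> powers_inv s \<and> sizes_inv s"
  let ?I = "\<lambda>i s. ?R s \<and> (\<forall>q. arr s ''D'' q = (if q < i then bdist (q div M) (q mod M) else 0))"
  have "hoare K (?I 0) distances_com (2 + M * M * (1 + 2)) (?I (M * M))"
    unfolding distances_com_def
  proof (rule hoare_for)
    fix i assume i: "i < M * M"
    let ?r = "i div M div 2 * M + i mod M div 2"
    have val: "(if ?r < i then bdist (?r div M) (?r mod M) else 0) +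
        (1 - of_bool (i div M mod 2 = i mod M mod 2)) = bdist (i div M) (i mod M)"
    proof -
      have "(if ?r < i then bdist (?r div M) (?r mod M) else 0) = bdist (i div M div 2) (i mod M div 2)"
      proof (cases "?r < i")
        case True then show ?thesis using div_div_mod_pair(2,3)[OF i] by simp
      next
        case False
        \<comment> \<open>Index 0 refers to itself, and its cell still holds the initial 0, which is
          the correct distance.\<close>
        then have "i = 0" using div_div_mod_pair(1,4)[OF i] by linarith
        then show ?thesis by (simp add: bdist_def)
      qed
      moreover have "1 - of_bool (i div M mod 2 = i mod M mod 2) = (of_bool (odd (i div M) \<noteq> odd (i mod M)) :: nat)"
        by (auto simp: mod_2_eq_odd)
      ultimately show ?thesis using bdist_rec[of "i div M" "i mod M"] by simp
    qed
    have le: "bdist (i div M) (i mod M) \<le> K" using bdist_pair_le[OF i] m_le_K by simp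
    show "hoare K (\<lambda>s. ?I i s \<and> reg s ''i'' = i) (Store ''D'' (V ''i'')
       (Arr ''D'' (V ''i'' [div] V ''M'' [div] N 2 [*] V ''M'' [+] V ''i'' [mod] V ''M'' [div] N 2) [+]
        (N 1 [-] (V ''i'' [div] V ''M'' [mod] N 2 [=] V ''i'' [mod] V ''M'' [mod] N 2))))
       1 (\<lambda>s. ?I (Suc i) s \<and> reg s ''i'' = i)"
      apply (rule hoare_store)
        apply (simp add: small_le_K)
      subgoal for s
        using val le by (simp add: sizes_inv_def)
      subgoal for s
        using val by (auto simp: inv_defs less_Suc_eq)
      done
  qed (auto simp: inv_defs small_le_K MM_le_K)
  then show ?thesis by (rule hoare_conseq) (auto simp: inv_defs)
qed


section \<open>The greedy construction of the code\<close>

definition codes_inv :: "nat \<Rightarrow> (nat \<Rightarrow> nat) \<Rightarrow> bool" where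
  "codes_inv u c \<longleftrightarrow> (\<forall>v<u. c v \<in> dbl (8 * m) ` {..<2 ^ (8 * m)}) \<and>
     (\<forall>v<u. \<forall>v'<u. v \<noteq> v' \<longrightarrow> 2 * m \<le> bdist (c v) (c v'))"

definition covered :: "(nat \<Rightarrow> nat) \<Rightarrow> nat \<Rightarrow> nat \<Rightarrow> bool" where
  "covered c u a \<longleftrightarrow> (\<exists>v<u. bdist (c v) (dbl (8 * m) a) < 2 * m)"

lemma codes_inv_upd: "codes_inv u (c(u := x)) \<longleftrightarrow> codes_inv u c"
  by (simp add: codes_inv_def)

lemma covered_upd: "covered (c(u := x)) u a \<longleftrightarrow> covered c u a"
  by (auto simp: covered_def)

lemma codes_inv_less:
  assumes "codes_inv u c" "v < u"
  shows "c v < M"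
  using assms dbl_less[of _ "8 * m"] unfolding codes_inv_def M_def by auto

text \<open>The covering argument is applied to the words before doubling, at distance
  \<open>m\<close>; \<open>bdist_dbl\<close> turns this into \<open>2 * m\<close>.\<close>

lemma uncovered:
  assumes "codes_inv u c" "u < n"
  shows "\<exists>a<2 ^ (8 * m). \<not> covered c u a"
proof -
  obtain f where f: "\<And>v. v < u \<Longrightarrow> f v < 2 ^ (8 * m) \<and> c v = dbl (8 * m) (f v)"
  proof -
    have "\<forall>v. \<exists>a. v < u \<longrightarrow> a < 2 ^ (8 * m) \<and> c v = dbl (8 * m) a"
      using assms(1) unfolding codes_inv_def by blast
    then show ?thesis using that by metis
  qed
  obtain a where a: "a < 2 ^ (8 * m)" "\<And>v. v < u \<Longrightarrow> m \<le> bdist (f v) a"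
    using uncovered_exists[of u n m f] f assms(2) n_less by auto
  have "2 * m \<le> bdist (c v) (dbl (8 * m) a)" if "v < u" for v
    using f[OF that] a(2)[OF that] bdist_dbl[OF _ a(1), of "f v"] by simp
  then have "\<not> covered c u a" unfolding covered_def by (meson not_le)
  then show ?thesis using a(1) by blast
qed

lemma codes_inv_Suc:
  assumes "codes_inv u c" "c u = dbl (8 * m) a" "a < 2 ^ (8 * m)" "\<not> covered c u a"
  shows "codes_inv (Suc u) c"
proof -
  have "2 * m \<le> bdist (c v) (c u)" if "v < u" for v
    using assms(2,4) that unfolding covered_def by (metis not_less)
  moreover from this have "2 * m \<le> bdist (c u) (c v)" if "v < u" for v
    using that bdist_commute[of "c u" "c v"] by simp
  moreover have "c u \<in> dbl (8 * m) ` {..<2 ^ (8 * m)}" using assms(2,3) by simp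
  ultimately show ?thesis using assms(1) unfolding codes_inv_def less_Suc_eq by metis
qed

lemma covered_Suc: "covered c (Suc u) a \<longleftrightarrow> covered c u a \<or> bdist (c u) (dbl (8 * m) a) < 2 * m"
  unfolding covered_def by (auto simp: less_Suc_eq)

lemma lookup_distance:
  assumes "distances_inv s" "y < M" "z < M"
  shows "arr s ''D'' (y * M + z) = bdist y z"
  using assms mult_add_less_mult[OF assms(2,3)] by (auto simp: distances_inv_def)

lemma dbl_less_M: "a < 2 ^ (8 * m) \<Longrightarrow> dbl (8 * m) a < M"
  using dbl_less[of a "8 * m"] by (simp add: M_def)

lemma code_correct:
  "hoare K
     (\<lambda>s. input_inv s \<and> tape s = [] \<and> zero ''H'' s \<and> zero ''F'' s
       \<and> powers_inv s \<and> sizes_inv s \<and> distances_inv s)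
     code_com (2 + n * (2 + 2 ^ (8 * m) * (2 + 2) + (2 + 2 ^ (8 * m) * (1 + 2)) + 2))
     (\<lambda>s. input_inv s \<and> tape s = [] \<and> zero ''F'' s
       \<and> powers_inv s \<and> sizes_inv s \<and> distances_inv s \<and> is_code n m (arr s ''C''))"
proof -
  let ?Q = "2 ^ (8 * m) :: nat"
  let ?R = "\<lambda>s. input_inv s \<and> tape s = [] \<and> zero ''F'' s \<and> powers_inv s \<and> sizes_inv s \<and> distances_inv s"
  let ?J = "\<lambda>u s. ?R s \<and> codes_inv u (arr s ''C'') \<and>
    (\<forall>a<?Q. arr s ''H'' a = of_bool (covered (arr s ''C'') u a))"
  have Q: "?Q \<le> K" using m_le by (intro power_le_K) simp
  have dbl: "aval dbl_exp s = dbl (8 * m) (reg s ''i'')" if "?R s" for s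
    using that by (simp add: dbl_exp_def dbl_def sizes_inv_def)
  have legal: "consts_le K dbl_exp" "asize dbl_exp = 7" by (simp_all add: dbl_exp_def small_le_K)
  have R_i: "?R (s\<lparr>reg := (reg s)(''i'' := v)\<rparr>) = ?R s" for s v
    by (simp add: inv_defs)
  have R_C: "?R (s\<lparr>arr := (arr s)(''C'' := v)\<rparr>) = ?R s" for s v
    by (simp add: inv_defs)
  have R_H: "?R (s\<lparr>arr := (arr s)(''H'' := v)\<rparr>) = ?R s" for s v
    by (simp add: inv_defs)
  have choose: "hoare K (\<lambda>s. ?J u s \<and> reg s ''u'' = u)
     (For ''i'' (V ''Q'') (Cond (Arr ''H'' (V ''i'')) Skip (Store ''C'' (V ''u'') dbl_exp)))
     (2 + ?Q * (2 + 2))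
     (\<lambda>s. ?J u s \<and> reg s ''u'' = u \<and> codes_inv (Suc u) (arr s ''C''))" (is "hoare _ _ ?c _ _")
    if u: "u < n" for u
  proof -
    \<comment> \<open>Once a free candidate has been met, cell \<open>u\<close> of \<open>C\<close>
      holds a free one, and \<open>uncovered\<close> guarantees that one is met. Being covered
      concerns only codewords before \<open>u\<close>, so writing cell \<open>u\<close> does not
      affect it.\<close>
    let ?I = "\<lambda>i s. ?J u s \<and> reg s ''u'' = u \<and>
      ((\<exists>a<i. \<not> covered (arr s ''C'') u a) \<longrightarrow>
       (\<exists>a<?Q. \<not> covered (arr s ''C'') u a \<and> arr s ''C'' u = dbl (8 * m) a))"
    have "hoare K (?I 0) ?c (2 + ?Q * ((1 + 1) + 2)) (?I ?Q)"
    proof (rule hoare_for)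
      fix i :: nat and s v assume "?I i s"
      then show "?I i (s\<lparr>reg := (reg s)(''i'' := v)\<rparr>)"
        using R_i[of s v] by simp
    next
      fix i assume i: "i < ?Q"
      have free: "\<not> covered (arr s ''C'') u i" if "?I i s" "arr s ''H'' i = 0" for s
      proof -
        have "arr s ''H'' i = of_bool (covered (arr s ''C'') u i)" using that(1) i by blast
        then show ?thesis using that(2) by simp
      qed
      show "hoare K (\<lambda>s. ?I i s \<and> reg s ''i'' = i)
        (Cond (Arr ''H'' (V ''i'')) Skip (Store ''C'' (V ''u'') dbl_exp)) (1 + 1)
        (\<lambda>s. ?I (Suc i) s \<and> reg s ''i'' = i)"
        apply (intro hoare_cond hoare_skip hoare_store)
            apply (simp add: small_le_K)
        subgoal for s
          using i by (auto simp: less_Suc_eq)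
          apply (simp add: legal small_le_K)
        subgoal for s
          using dbl[of s] dbl_less_M[OF i] M_le_K by simp
        subgoal premises prems for s
        proof -
          have prem: "?I i s" "reg s ''i'' = i" "aval (Arr ''H'' (V ''i'')) s = 0"
            using prems(2) by blast+
          then have "arr s ''H'' i = 0" by simp
          with prem(1) have uncov: "\<not> covered (arr s ''C'') u i" by (rule free)
          have val: "aval dbl_exp s = dbl (8 * m) i" using dbl prem by metis
          have "?R (s\<lparr>arr := (arr s)(''C'' := v)\<rparr>)" for v using R_C prem(1) by blast
          moreover have "codes_inv u (arr s ''C'')"
            "\<forall>a<?Q. arr s ''H'' a = of_bool (covered (arr s ''C'') u a)" "reg s ''u'' = u"
            using prem(1) by blast+
          moreover have "\<exists>a<?Q. \<not> covered (arr s ''C'') u a \<and> dbl (8 * m) i = dbl (8 * m) a"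
            using uncov i by blast
          ultimately show ?thesis
            using prem(2) by (simp add: val codes_inv_upd covered_upd)
        qed
        done
    qed (auto simp: sizes_inv_def small_le_K Q)
    then have "hoare K (?I 0) ?c (2 + ?Q * (2 + 2)) (?I ?Q)" by (simp only: one_add_one)
    then show ?thesis
    proof (rule hoare_conseq)
      fix s assume *: "?I ?Q s"
      then obtain a where "a < ?Q" "\<not> covered (arr s ''C'') u a" "arr s ''C'' u = dbl (8 * m) a"
        using uncovered[of u "arr s ''C''"] u by blast
      then show "?J u s \<and> reg s ''u'' = u \<and> codes_inv (Suc u) (arr s ''C'')"
        using * codes_inv_Suc by blast
    qed simp
  qed
  have cover: "hoare K (\<lambda>s. ?J u s \<and> reg s ''u'' = u \<and> codes_inv (Suc u) (arr s ''C''))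
     (For ''i'' (V ''Q'') (Store ''H'' (V ''i'') (N 0 [<] Arr ''H'' (V ''i'') [+]
        (Arr ''D'' (Arr ''C'' (V ''u'') [*] V ''M'' [+] dbl_exp) [<] N 2 [*] V ''m''))))
     (2 + ?Q * (1 + 2))
     (\<lambda>s. ?J (Suc u) s \<and> reg s ''u'' = u)" (is "hoare _ _ ?c _ _")
    for u
  proof -
    \<comment> \<open>Candidates below \<open>i\<close> are already compared with the new codeword,
      the others only with the earlier ones.\<close>
    let ?I = "\<lambda>i s. ?R s \<and> reg s ''u'' = u \<and> codes_inv (Suc u) (arr s ''C'') \<and>
      (\<forall>a<?Q. arr s ''H'' a = of_bool (covered (arr s ''C'') (if a < i then Suc u else u) a))"
    have "hoare K (?I 0) ?c (2 + ?Q * (1 + 2)) (?I ?Q)"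
    proof (rule hoare_for)
      fix i :: nat and s v assume "?I i s"
      then show "?I i (s\<lparr>reg := (reg s)(''i'' := v)\<rparr>)"
        using R_i[of s v] by simp
    next
      fix i assume i: "i < ?Q"
      have lookup: "arr s ''D'' (arr s ''C'' u * M + dbl (8 * m) i) = bdist (arr s ''C'' u) (dbl (8 * m) i)"
        if "?I i s" for s
        using that lookup_distance[OF _ codes_inv_less[of "Suc u" "arr s ''C''" u] dbl_less_M[OF i]]
        by blast
      show "hoare K (\<lambda>s. ?I i s \<and> reg s ''i'' = i)
        (Store ''H'' (V ''i'') (N 0 [<] Arr ''H'' (V ''i'') [+]
        (Arr ''D'' (Arr ''C'' (V ''u'') [*] V ''M'' [+] dbl_exp) [<] N 2 [*] V ''m''))) 1
        (\<lambda>s. ?I (Suc i) s \<and> reg s ''i'' = i)"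
        apply (rule hoare_store)
          apply (simp add: legal small_le_K)
         apply (simp add: small_le_K)
        subgoal for s
          using dbl[of s] i R_H[of s] lookup[of s]
          by (auto simp: less_Suc_eq covered_Suc sizes_inv_def)
        done
    qed (auto simp: sizes_inv_def small_le_K Q)
    then show ?thesis by (rule hoare_conseq) auto
  qed
  have "hoare K (?J 0) code_com (2 + n * ((2 + ?Q * (2 + 2) + (2 + ?Q * (1 + 2))) + 2)) (?J n)"
    unfolding code_com_def
  proof (rule hoare_for)
    fix i :: nat and s v assume "?J i s"
    then show "?J i (s\<lparr>reg := (reg s)(''u'' := v)\<rparr>)"
      by (simp add: inv_defs)
  qed (use hoare_seq[OF choose cover] in \<open>auto simp: input_inv_def small_le_K n_le_K\<close>)
  then show ?thesis
    by (rule hoare_conseq) (auto simp: is_code_def codes_inv_def covered_def zero_def)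
qed


section \<open>The table of compatible pairs\<close>

definition hit :: "(nat \<Rightarrow> nat) \<Rightarrow> nat \<Rightarrow> nat \<Rightarrow> bool" where
  "hit c e q \<longleftrightarrow> (e div n, e mod n) \<in> E \<and>
     bdist (q div M) (c (e div n)) < m \<and> bdist (q mod M) (c (e mod n)) < m"

text \<open>Matrix position \<open>e\<close> stands for the vertex pair
  \<open>(e div n, e mod n)\<close>; since edges join vertices below \<open>n\<close>, these
  positions reach every edge.\<close>

lemma hit_iff_compat: "(\<exists>e<n * n. hit c e q) \<longleftrightarrow> compat E m c (q div M) (q mod M)"
proof
  assume "compat E m c (q div M) (q mod M)"
  then obtain u v where uv: "(u, v) \<in> E" "bdist (q div M) (c u) < m" "bdist (q mod M) (c v) < m"
    unfolding compat_def by auto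
  then have "u < n" "v < n" using graph unfolding simple_graph_def by auto
  then have "u * n + v < n * n" "(u * n + v) div n = u" "(u * n + v) mod n = v"
    by (auto intro: mult_add_less_mult)
  then show "\<exists>e<n * n. hit c e q" using uv unfolding hit_def by metis
qed (auto simp: hit_def compat_def)

definition compat_inv :: "(nat \<Rightarrow> nat) \<Rightarrow> state \<Rightarrow> bool" where
  "compat_inv c s \<longleftrightarrow> (\<forall>q<M * M. arr s ''F'' q = of_bool (compat E m c (q div M) (q mod M)))"

lemma compat_correct:
  "hoare K
     (\<lambda>s. input_inv s \<and> tape s = [] \<and> zero ''F'' s
       \<and> powers_inv s \<and> sizes_inv s \<and> distances_inv s \<and> is_code n m (arr s ''C''))
     compat_com (2 + n * n * (M * M) * (1 + 2))
     (\<lambda>s. input_inv s \<and> tape s = [] \<and> powers_inv s \<and> sizes_inv s \<and>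
       is_code n m (arr s ''C'') \<and> compat_inv (arr s ''C'') s)"
proof -
  let ?MM = "M * M"
  let ?R = "\<lambda>s. input_inv s \<and> tape s = [] \<and> powers_inv s \<and> sizes_inv s \<and> distances_inv s \<and>
    is_code n m (arr s ''C'')"
  \<comment> \<open>Cell \<open>q\<close> collects the disjunction of those earlier rounds whose
    remainder is \<open>q\<close>.\<close>
  let ?I = "\<lambda>i s. ?R s \<and> (\<forall>q<?MM. arr s ''F'' q =
    of_bool (\<exists>i'<i. i' mod ?MM = q \<and> hit (arr s ''C'') (i' div ?MM) q))"
  have MM: "0 < ?MM" using M_pos by simp
  have "hoare K (?I 0) compat_com (2 + n * n * ?MM * (1 + 2)) (?I (n * n * ?MM))"
    unfolding compat_com_def
  proof (rule hoare_for)
    show "n * n * ?MM \<le> K" unfolding K_def by simp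
    fix i assume i: "i < n * n * ?MM"
    have e: "i div ?MM < n * n" using i by (simp add: less_mult_imp_div_less)
    then have uv: "i div ?MM div n < n" "i div ?MM mod n < n"
      using n_pos by (simp_all add: less_mult_imp_div_less)
    have q: "i mod ?MM < ?MM" using MM by simp
    then have yz: "i mod ?MM div M < M" "i mod ?MM mod M < M"
      using M_pos by (simp_all add: less_mult_imp_div_less del: mod_mod_cancel mod_mult_self1 mod_mult_self2)
    have edge: "aval edge_exp s = i div ?MM" and pair: "aval pair_exp s = i mod ?MM"
      if "?I i s" "reg s ''i'' = i" for s
      using that by (simp_all add: edge_exp_def pair_exp_def sizes_inv_def)
    have R: "?R (s\<lparr>arr := (arr s)(''F'' := v)\<rparr>) = ?R s" for s v
      by (simp add: inv_defs)
    have val: "aval (N 0 [<] Arr ''F'' pair_exp [+] Arr ''G'' edge_exp [*]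
       ((Arr ''D'' (pair_exp [div] V ''M'' [*] V ''M'' [+] Arr ''C'' (edge_exp [div] V ''n'')) [<] V ''m'') [*]
        (Arr ''D'' (pair_exp [mod] V ''M'' [*] V ''M'' [+] Arr ''C'' (edge_exp [mod] V ''n'')) [<] V ''m''))) s =
      of_bool (\<exists>i'<Suc i. i' mod ?MM = i mod ?MM \<and> hit (arr s ''C'') (i' div ?MM) (i mod ?MM))"
      if s: "?I i s" "reg s ''i'' = i" for s
    proof -
      have c: "arr s ''C'' u < M" if "u < n" for u
        using code_less[OF _ that] s(1) unfolding M_def by blast
      have "arr s ''D'' (i mod ?MM div M * M + arr s ''C'' (i div ?MM div n)) =
          bdist (i mod ?MM div M) (arr s ''C'' (i div ?MM div n))"
        "arr s ''D'' (i mod ?MM mod M * M + arr s ''C'' (i div ?MM mod n)) =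
          bdist (i mod ?MM mod M) (arr s ''C'' (i div ?MM mod n))"
        using s(1) yz c[OF uv(1)] c[OF uv(2)] by (blast intro: lookup_distance)+
      moreover have "arr s ''F'' (i mod ?MM) =
          of_bool (\<exists>i'<i. i' mod ?MM = i mod ?MM \<and> hit (arr s ''C'') (i' div ?MM) (i mod ?MM))"
        using s(1) q by blast
      moreover have "arr s ''G'' (i div ?MM) = of_bool ((i div ?MM div n, i div ?MM mod n) \<in> E)"
        using s(1) e by (simp add: input_inv_def)
      moreover have "reg s ''n'' = n" "reg s ''m'' = m" "reg s ''M'' = M"
        using s(1) by (auto simp: input_inv_def sizes_inv_def)
      ultimately show ?thesis
        using edge[OF s] pair[OF s]
        by (auto simp: less_Suc_eq hit_def simp del: mod_mod_cancel)
    qed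
    have sz: "consts_le K pair_exp" "asize pair_exp = 5" "consts_le K edge_exp" "asize edge_exp = 5"
      by (simp_all add: pair_exp_def edge_exp_def)
    show "hoare K (\<lambda>s. ?I i s \<and> reg s ''i'' = i) (Store ''F'' pair_exp (N 0 [<] Arr ''F'' pair_exp [+] Arr ''G'' edge_exp [*]
       ((Arr ''D'' (pair_exp [div] V ''M'' [*] V ''M'' [+] Arr ''C'' (edge_exp [div] V ''n'')) [<] V ''m'') [*]
        (Arr ''D'' (pair_exp [mod] V ''M'' [*] V ''M'' [+] Arr ''C'' (edge_exp [mod] V ''n'')) [<] V ''m''))))
        1 (\<lambda>s. ?I (Suc i) s \<and> reg s ''i'' = i)"
    proof (rule hoare_store)
      fix s assume "?I i s \<and> reg s ''i'' = i"
      then have s: "?I i s" "reg s ''i'' = i" by blast+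
      show "aval (N 0 [<] Arr ''F'' pair_exp [+] Arr ''G'' edge_exp [*]
       ((Arr ''D'' (pair_exp [div] V ''M'' [*] V ''M'' [+] Arr ''C'' (edge_exp [div] V ''n'')) [<] V ''m'') [*]
        (Arr ''D'' (pair_exp [mod] V ''M'' [*] V ''M'' [+] Arr ''C'' (edge_exp [mod] V ''n'')) [<] V ''m''))) s \<le> K"
        unfolding val[OF s] by (simp add: small_le_K)
      show "(\<lambda>s. ?I (Suc i) s \<and> reg s ''i'' = i) (s\<lparr>arr := (arr s)(''F'' := (arr s ''F'')
        (aval pair_exp s := aval (N 0 [<] Arr ''F'' pair_exp [+] Arr ''G'' edge_exp [*]
       ((Arr ''D'' (pair_exp [div] V ''M'' [*] V ''M'' [+] Arr ''C'' (edge_exp [div] V ''n'')) [<] V ''m'') [*]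
        (Arr ''D'' (pair_exp [mod] V ''M'' [*] V ''M'' [+] Arr ''C'' (edge_exp [mod] V ''n'')) [<] V ''m''))) s))\<rparr>)"
        unfolding val[OF s] pair[OF s] using s R[of s] by (auto simp: less_Suc_eq)
    qed (simp add: sz small_le_K)
  qed (auto simp: inv_defs small_le_K)
  then show ?thesis
  proof (rule hoare_conseq)
    fix s assume s: "?I (n * n * ?MM) s"
    have "(\<exists>i'<n * n * ?MM. i' mod ?MM = q \<and> hit c (i' div ?MM) q) \<longleftrightarrow> (\<exists>e<n * n. hit c e q)"
      if "q < ?MM" for c q
    proof
      assume "\<exists>e<n * n. hit c e q"
      then obtain e where "e < n * n" "hit c e q" by blast
      moreover have "(e * B + q) div B = e" if "q < B" for B using that by auto
      from this[OF that] have "(e * ?MM + q) div ?MM = e" .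
      ultimately show "\<exists>i'<n * n * ?MM. i' mod ?MM = q \<and> hit c (i' div ?MM) q"
        using mult_add_less_mult[of e "n * n" q ?MM] that by (intro exI[of _ "e * ?MM + q"]) auto
    qed (use less_mult_imp_div_less in blast)
    with s show "input_inv s \<and> tape s = [] \<and> powers_inv s \<and> sizes_inv s \<and>
       is_code n m (arr s ''C'') \<and> compat_inv (arr s ''C'') s"
      unfolding compat_inv_def hit_iff_compat by simp
  qed (auto simp: zero_def)
qed

end

section \<open>The output tape, addressed by a single bit counter\<close>

lemma concat_map_upt:
  "concat (map (\<lambda>a. map (f a) [0..<L]) [0..<k]) = map (\<lambda>x. f (x div L) (x mod L)) [0..<k * L]"
proof (induction k)
  case (Suc k)
  have "[0..<Suc k * L] = [0..<k * L] @ map (\<lambda>i. i + k * L) [0..<L]"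
    using upt_add_eq_append[of 0 "k * L" L] map_add_upt[of "k * L" L] by (simp add: add.commute)
  then show ?case using Suc by simp
qed simp

context clique_instance begin

definition d :: nat where "d = 8 * k * m + 15 * m"
definition num :: nat where "num = k * k * (M * M) * 2 ^ k"

definition tape_bit :: "(nat \<Rightarrow> nat) \<Rightarrow> nat \<Rightarrow> bool" where
  "tape_bit c x = (let X = x div (k * (16 * m)); p = x mod (k * (16 * m));
      q = X div 2 ^ k mod (M * M); e = X div 2 ^ k div (M * M)
    in test_bit E m c (e div k) (e mod k) (q div M) (q mod M) (X mod 2 ^ k) (p div (16 * m)) (p mod (16 * m)))"

lemma output_tape_test_strings:
  "output_tape (k * (16 * m)) d (test_strings E k m c) =
     [k * (16 * m), d, num] @ map (\<lambda>x. of_bool (tape_bit c x)) [0..<num * (k * (16 * m))]"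
  unfolding output_tape_def test_strings_def test_string_def
  by (simp add: num_def M_def comp_def Let_def concat_map_upt tape_bit_def)

lemma aval_if_exp:
  assumes "aval b s = of_bool P"
  shows "aval (if_exp b e1 e2) s = (if P then aval e1 s else aval e2 s)"
  using assms by (simp add: if_exp_def)

lemma div_power_mod_2: "y div 2 ^ b mod 2 = of_bool (bit y b)" for y :: nat
  by (simp add: bit_iff_odd mod_2_eq_odd)

lemma aval_bit_exp:
  assumes "input_inv s" "powers_inv s" "sizes_inv s" "compat_inv c s" "reg s ''i'' = x"
  shows "aval bit_exp s = of_bool (tape_bit c x)"
proof -
  define X p where "X = x div (k * (16 * m))" and "p = x mod (k * (16 * m))"
  define q e where "q = X div 2 ^ k mod (M * M)" and "e = X div 2 ^ k div (M * M)"
  have "p < k * (16 * m)" using k_pos m_pos by (simp add: p_def)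
  then have block: "p div (16 * m) < k" by (simp add: less_mult_imp_div_less)
  have pos: "p mod (16 * m) < 16 * m" using m_pos by simp
  \<comment> \<open>All lookups stay in the table: \<open>k\<close> is at most \<open>n\<close>,
    block numbers are below \<open>k\<close>, and positions in a block are below
    \<open>16 * m\<close>.\<close>
  have P: "arr s ''P'' a = 2 ^ a" if "a \<le> 16 * n" for a
    using assms(2) that by (simp add: powers_inv_def)
  have Pk: "arr s ''P'' k = 2 ^ k" using P[of k] k_le by simp
  have Pblock: "arr s ''P'' (p div (16 * m)) = 2 ^ (p div (16 * m))"
    using P[of "p div (16 * m)"] block k_le by simp
  have Ppos: "arr s ''P'' (p mod (16 * m)) = 2 ^ (p mod (16 * m))"
    using P[of "p mod (16 * m)"] pos m_le by simp
  have regs: "reg s ''k'' = k" "reg s ''M'' = M" "reg s ''m'' = m" "reg s ''L'' = k * (16 * m)"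
    using assms(1,3) by (simp_all add: input_inv_def sizes_inv_def)
  have q: "q < M * M" using M_pos by (simp add: q_def)
  have pair: "aval code_pair_exp s = q"
    by (simp add: code_pair_exp_def regs Pk assms(5) q_def X_def)
  have index: "aval index_pair_exp s = e"
    by (simp add: index_pair_exp_def regs Pk assms(5) e_def X_def)
  have blk: "aval block_exp s = p div (16 * m)"
    by (simp add: block_exp_def regs assms(5) p_def)
  have pow: "aval power_exp s = 2 ^ (p mod (16 * m))"
    using Ppos by (simp add: power_exp_def regs assms(5) p_def)
  let ?act = "e div k \<noteq> e mod k \<and> \<not> compat E m c (q div M) (q mod M)"
  have act: "aval active_exp s = of_bool ?act"
    using q assms(4) by (simp add: active_exp_def pair index regs compat_inv_def)
  have "aval bit_exp s = (if ?act \<and> p div (16 * m) = e div k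
      then 1 - of_bool (bit (q div M) (p mod (16 * m)))
      else if ?act \<and> p div (16 * m) = e mod k
        then 1 - of_bool (bit (q mod M) (p mod (16 * m)))
        else of_bool (bit (X mod 2 ^ k) (p div (16 * m))))"
    unfolding bit_exp_def
    by (subst aval_if_exp[where P = "?act \<and> p div (16 * m) = e div k"],
        simp add: act blk index regs,
        subst aval_if_exp[where P = "?act \<and> p div (16 * m) = e mod k"],
        simp add: act blk index regs)
      (simp add: pair pow regs Pk blk Pblock assms(5) X_def[symmetric] div_power_mod_2)
  also have "\<dots> = of_bool (test_bit E m c (e div k) (e mod k) (q div M) (q mod M) (X mod 2 ^ k)
      (p div (16 * m)) (p mod (16 * m)))"
    by (auto simp: test_bit_def)
  also have "\<dots> = of_bool (tape_bit c x)"
    by (simp add: tape_bit_def Let_def X_def p_def q_def e_def)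
  finally show ?thesis .
qed

lemma output_correct:
  "hoare K
     (\<lambda>s. input_inv s \<and> tape s = [] \<and> powers_inv s \<and> sizes_inv s \<and>
       is_code n m (arr s ''C'') \<and> compat_inv (arr s ''C'') s)
     (header_com ;; bits_com) (1 + (1 + 1) + (2 + num * (k * (16 * m)) * (1 + 2)))
     (\<lambda>s. \<exists>c. is_code n m c \<and> tape s = output_tape (k * (16 * m)) d (test_strings E k m c))"
proof -
  let ?R = "\<lambda>s. input_inv s \<and> powers_inv s \<and> sizes_inv s \<and>
       is_code n m (arr s ''C'') \<and> compat_inv (arr s ''C'') s"
  have R_tape: "?R (s\<lparr>tape := v\<rparr>) = ?R s" for s v
    by (simp add: inv_defs compat_inv_def)
  have R_i: "?R (s\<lparr>reg := (reg s)(''i'' := v)\<rparr>) = ?R s" for s v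
    by (simp add: inv_defs compat_inv_def)
  have regs: "reg s ''k'' = k" "reg s ''M'' = M" "reg s ''m'' = m" "reg s ''L'' = k * (16 * m)"
    "arr s ''P'' k = 2 ^ k" if "?R s" for s
    using that k_le by (simp_all add: input_inv_def sizes_inv_def powers_inv_def)
  let ?L = "k * (16 * m)"
  have header: "hoare K (\<lambda>s. ?R s \<and> tape s = []) header_com (1 + (1 + 1))
      (\<lambda>s. ?R s \<and> tape s = [?L, d, num])"
    unfolding header_com_def
    apply (rule hoare_seq[OF hoare_output[where Q = "\<lambda>s. ?R s \<and> tape s = [?L]"]])
      apply simp
    subgoal for s using regs[of s] R_tape[where s = s] by simp
    apply (rule hoare_seq[OF hoare_output[where Q = "\<lambda>s. ?R s \<and> tape s = [?L, d]"]])
      apply (simp add: small_le_K)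
    subgoal for s using regs[of s] R_tape[where s = s] by (simp add: d_def)
    apply (rule hoare_output)
      apply (simp add: small_le_K)
    subgoal for s using regs[of s] R_tape[where s = s] by (simp add: num_def)
    done
  let ?I = "\<lambda>x s. ?R s \<and> tape s = [?L, d, num] @ map (\<lambda>x. of_bool (tape_bit (arr s ''C'') x)) [0..<x]"
  have sz: "consts_le K bit_exp" "asize bit_exp \<le> 1000"
    by (simp_all add: bit_exp_def if_exp_def active_exp_def code_pair_exp_def index_pair_exp_def
        power_exp_def block_exp_def small_le_K)
  have bits: "hoare K (?I 0) bits_com (2 + num * ?L * (1 + 2)) (?I (num * ?L))"
    unfolding bits_com_def
  proof (rule hoare_for)
    show "num * ?L \<le> K" unfolding K_def num_def by simp
    fix x
    show "hoare K (\<lambda>s. ?I x s \<and> reg s ''i'' = x) (Output bit_exp) 1 (\<lambda>s. ?I (Suc x) s \<and> reg s ''i'' = x)"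
    proof (rule hoare_output)
      fix s assume s: "?I x s \<and> reg s ''i'' = x"
      have "aval bit_exp s = of_bool (tape_bit (arr s ''C'') x)"
        using s by (intro aval_bit_exp) blast+
      then show "?I (Suc x) (s\<lparr>tape := tape s @ [aval bit_exp s]\<rparr>) \<and>
          reg (s\<lparr>tape := tape s @ [aval bit_exp s]\<rparr>) ''i'' = x"
        using s R_tape[where s = s] by simp
    qed (use sz in simp)
  next
    fix i v s assume "?I i s"
    then show "?I i (s\<lparr>reg := (reg s)(''i'' := v)\<rparr>)" using R_i[of s v] by simp
  next
    fix i s assume "?I i s"
    then show "aval (V ''k'' [*] V ''k'' [*] (V ''M'' [*] V ''M'') [*] Arr ''P'' (V ''k'') [*] V ''L'') s = num * ?L"
      using regs[of s] by (simp add: num_def)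
  qed (simp_all add: small_le_K)
  show ?thesis
  proof (rule hoare_seq)
    show "hoare K (\<lambda>s. input_inv s \<and> tape s = [] \<and> powers_inv s \<and> sizes_inv s \<and>
       is_code n m (arr s ''C'') \<and> compat_inv (arr s ''C'') s) header_com (1 + (1 + 1)) (?I 0)"
      using header by (rule hoare_conseq) auto
    show "hoare K (?I 0) bits_com (2 + num * ?L * (1 + 2))
        (\<lambda>s. \<exists>c. is_code n m c \<and> tape s = output_tape ?L d (test_strings E k m c))"
      using bits by (rule hoare_conseq) (auto simp: output_tape_test_strings)
  qed
qed

end

section \<open>Running time\<close>

text \<open>\<open>X\<close> stands for \<open>n\<close>, and \<open>Y\<close> bounds
  \<open>M\<close>, because \<open>2 ^ m\<close> is at most \<open>2 * n\<close>. The summands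
  follow the phases; only the last one, for the output loop, carries the factor
  \<open>2 ^ k\<close>, which is split off.\<close>

definition steps_poly :: "nat poly" where
  "steps_poly = (let X = [:0, 1:]; Y = (2 * X) ^ 16 in
     20 + 51 * X + 3 * (Y * Y) + X * (6 + 7 * Y) + 3 * (X * X * (Y * Y)) + 48 * (X * X * X * X * (Y * Y)))"

text \<open>The part \<open>X + 50\<close>, with \<open>X\<close> the variable, pays for the branch
  \<open>n < k\<close>; the other factor bounds \<open>step_cost K\<close>, as \<open>K\<close> has
  at most \<open>37 * n + 6\<close> binary digits.\<close>

definition time_poly :: "nat poly" where
  "time_poly = [:0, 1:] + 50 + steps_poly * (1 + 1000 ^ 2 * (37 * [:0, 1:] + 7))"

context clique_instance begin

definition steps :: nat where
  "steps = 1 + (2 + 16 * n * 3) + (2 + n * (1 + 2) + (1 + (1 + 1)) + (2 + M * M * (1 + 2) +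
    (2 + n * (2 + 2 ^ (8 * m) * (2 + 2) + (2 + 2 ^ (8 * m) * (1 + 2)) + 2) +
    (2 + n * n * (M * M) * (1 + 2) + (1 + (1 + 1) + (2 + num * (k * (16 * m)) * (1 + 2)))))))"

lemma reduction_correct:
  "hoare K
     (\<lambda>s. input_inv s \<and> tape s = [] \<and> reg s ''m'' = 0 \<and> zero ''D'' s \<and> zero ''H'' s \<and> zero ''F'' s)
     reduction (1 + steps)
     (\<lambda>s. \<exists>c. is_code n m c \<and> tape s = output_tape (k * (16 * m)) d (test_strings E k m c))"
  (is "hoare K ?P _ _ ?Q")
proof -
  have "hoare K ?P reduction_com steps ?Q"
    unfolding reduction_com_def steps_def
    by (intro hoare_seq[OF powers_correct] hoare_seq[OF sizes_correct] hoare_seq[OF distances_correct]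
        hoare_seq[OF code_correct] hoare_seq[OF compat_correct] output_correct)
  then have "hoare K (\<lambda>s. ?P s \<and> aval (V ''n'' [<] V ''k'') s = 0) reduction_com steps ?Q"
    by (rule hoare_conseq) auto
  \<comment> \<open>This branch is vacuous: the precondition fixes \<open>n\<close> and
    \<open>k\<close>, and the test fails as \<open>k\<close> is at most \<open>n\<close>.\<close>
  moreover have "hoare K (\<lambda>s. ?P s \<and> aval (V ''n'' [<] V ''k'') s \<noteq> 0) trivial_com steps ?Q"
    using k_le by (auto simp: hoare_def input_inv_def)
  ultimately show ?thesis unfolding reduction_def by (intro hoare_cond) simp_all
qed

section \<open>Polynomial bounds for the number and the cost of steps\<close>

lemma power_m_le: "2 ^ m \<le> 2 * n"
proof -
  have "2 ^ (m - 1) \<le> n" using floorlog_bounds[of n 2] n_pos by (simp add: m_def)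
  moreover have "(2::nat) ^ m = 2 * 2 ^ (m - 1)" using m_pos by (cases m) auto
  ultimately show ?thesis by simp
qed

lemma M_le: "M \<le> (2 * n) ^ 16"
proof -
  have "M = (2 ^ m) ^ 16" by (simp add: M_def mult.commute flip: power_mult)
  also have "\<dots> \<le> (2 * n) ^ 16" by (rule power_mono[OF power_m_le]) simp
  finally show ?thesis .
qed

lemma steps_le: "1 + steps \<le> 2 ^ k * poly steps_poly n"
proof -
  let ?Y = "(2 * n) ^ 16"
  have MM: "M * M \<le> ?Y * ?Y" using M_le by (intro mult_mono) auto
  have "2 ^ (8 * m) \<le> M" unfolding M_def by (intro power_increasing) auto
  then have Q: "2 ^ (8 * m) \<le> ?Y" using M_le by linarith
  have num: "num * (k * (16 * m)) \<le> 2 ^ k * (16 * (n * n * n * n * (?Y * ?Y)))"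
  proof -
    have "num * (k * (16 * m)) = 2 ^ k * (16 * (k * k * k * m * (M * M)))"
      by (simp add: num_def mult_ac)
    also have "\<dots> \<le> 2 ^ k * (16 * (n * n * n * n * (?Y * ?Y)))"
      by (intro mult_le_mono le_refl k_le m_le M_le)
    finally show ?thesis .
  qed
  define A where "A = 20 + 51 * n + 3 * (?Y * ?Y) + n * (6 + 7 * ?Y) + 3 * (n * n * (?Y * ?Y))"
  have sum: "1 + (1 + (2 + 16 * n * 3) + (2 + n * (1 + 2) + (1 + (1 + 1)) + (2 + b * (1 + 2) +
      (2 + a + (2 + c * (1 + 2) + (1 + (1 + 1) + (2 + e * (1 + 2))))))))
      \<le> 20 + 51 * n + 3 * b' + a' + 3 * c' + 3 * e'"
    if "a \<le> a'" "b \<le> b'" "c \<le> c'" "e \<le> e'" for a a' b b' c c' e e' :: nat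
    using that by simp
  have "n * (2 + 2 ^ (8 * m) * (2 + 2) + (2 + 2 ^ (8 * m) * (1 + 2)) + 2) \<le> n * (6 + 7 * ?Y)"
    using Q by (intro mult_left_mono) auto
  moreover have "n * n * (M * M) \<le> n * n * (?Y * ?Y)" using MM by (intro mult_left_mono) auto
  ultimately have "1 + steps \<le> A + 3 * (2 ^ k * (16 * (n * n * n * n * (?Y * ?Y))))"
    unfolding steps_def A_def by (rule sum[OF _ MM _ num])
  \<comment> \<open>Since \<open>2 ^ k\<close> is at least 1, the phases before the output loop fit
    under this factor too.\<close>
  also have "\<dots> \<le> 2 ^ k * A + 3 * (2 ^ k * (16 * (n * n * n * n * (?Y * ?Y))))" by simp
  also have "\<dots> = 2 ^ k * poly steps_poly n"
    by (simp add: steps_poly_def A_def Let_def algebra_simps)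
  finally show ?thesis .
qed

text \<open>In the largest summand \<open>M * M\<close> contributes \<open>32 * n\<close> to the
  exponent, the factors \<open>k\<close> (three times), \<open>m\<close> and \<open>2 ^ k\<close>
  contribute \<open>n\<close> each, and 16 contributes 4. Three summands cost at most two more
  digits.\<close>

lemma K_less: "K < 2 ^ (37 * n + 6)"
proof -
  have n: "n \<le> 2 ^ n" by (rule less_imp_le[OF less_exp])
  then have km: "k \<le> 2 ^ n" "m \<le> 2 ^ n" using k_le m_le by linarith+
  have M: "M \<le> 2 ^ (16 * n)" unfolding M_def using m_le by (intro power_increasing) auto
  have "n * n * (M * M) \<le> 2 ^ n * 2 ^ n * (2 ^ (16 * n) * 2 ^ (16 * n))"
    by (intro mult_le_mono n M)
  also have "\<dots> = 2 ^ (34 * n)" by (simp flip: power_add)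
  also have "\<dots> \<le> 2 ^ (37 * n + 4)" by (intro power_increasing) auto
  finally have 1: "n * n * (M * M) \<le> 2 ^ (37 * n + 4)" .
  have "k * k * (M * M) * 2 ^ k * (k * (16 * m)) \<le>
      2 ^ n * 2 ^ n * (2 ^ (16 * n) * 2 ^ (16 * n)) * 2 ^ n * (2 ^ n * (2 ^ 4 * 2 ^ n))"
    using k_le by (intro mult_le_mono km M power_increasing) auto
  also have "\<dots> = 2 ^ (37 * n + 4)" by (simp only: power_add[symmetric]) (simp add: algebra_simps)
  finally have 2: "k * k * (M * M) * 2 ^ k * (k * (16 * m)) \<le> 2 ^ (37 * n + 4)" .
  have 3: "(2::nat) ^ (16 * n) \<le> 2 ^ (37 * n + 4)" by (intro power_increasing) auto
  have "K \<le> 3 * 2 ^ (37 * n + 4)" using 1 2 3 unfolding K_def by linarith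
  also have "\<dots> < 2 ^ (37 * n + 6)" by (simp add: power_add)
  finally show ?thesis .
qed

lemma step_cost_le: "step_cost K \<le> poly (1 + 1000 ^ 2 * (37 * [:0, 1:] + 7)) n"
  using floorlog_le[OF K_less] by (simp add: step_cost_def lcost_def algebra_simps)

lemma reduction_exec:
  "\<exists>t s c. exec reduction (input_state n E k) t s \<and> t \<le> 2 ^ k * poly time_poly n \<and>
     is_code n m c \<and> tape s = output_tape (k * (16 * m)) d (test_strings E k m c)"
proof -
  let ?s = "input_state n E k"
  have "bounded K ?s"
    using n_le_K k_le small_le_K[of 0] small_le_K[of 1] by (simp add: bounded_def input_state_def of_bool_def)
  moreover have "input_inv ?s \<and> tape ?s = [] \<and> reg ?s ''m'' = 0 \<and> zero ''D'' ?s \<and> zero ''H'' ?s \<and> zero ''F'' ?s"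
    by (simp add: input_inv_def zero_def input_state_def)
  ultimately obtain t s where t: "exec reduction ?s t s" "t \<le> (1 + steps) * step_cost K"
    "\<exists>c. is_code n m c \<and> tape s = output_tape (k * (16 * m)) d (test_strings E k m c)"
    using hoareE[OF reduction_correct, of ?s] by metis
  note t(2)
  also have "(1 + steps) * step_cost K \<le>
      2 ^ k * poly steps_poly n * poly (1 + 1000 ^ 2 * (37 * [:0, 1:] + 7)) n"
    by (intro mult_le_mono steps_le step_cost_le)
  also have "\<dots> \<le> 2 ^ k * poly time_poly n"
    unfolding time_poly_def mult.assoc by (intro mult_left_mono) (simp_all add: mult.assoc)
  finally show ?thesis using t by blast
qed

end

section \<open>Instances with fewer than \<open>k\<close> vertices\<close>

lemma reduction_exec_trivial:
  assumes "n < k"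
  shows "\<exists>t s. exec reduction (input_state n E k) t s \<and> t \<le> 2 ^ k * poly time_poly n \<and>
     tape s = output_tape 1 0 [[False], [True]]"
proof -
  let ?s = "input_state n E k"
  let ?b = "V ''n'' [<] V ''k''"
  have regs: "reg ?s ''n'' = n" "reg ?s ''k'' = k" by (simp_all add: input_state_def)
  obtain t s where ts: "exec trivial_com ?s t s" "tape s = output_tape 1 0 [[False], [True]]"
    "t = 5 + (lcost 1 + (lcost 0 + (lcost 2 + (lcost 0 + lcost 1))))"
  proof -
    have "\<exists>t s. exec trivial_com ?s t s \<and> tape s = output_tape 1 0 [[False], [True]] \<and>
        t = 5 + (lcost 1 + (lcost 0 + (lcost 2 + (lcost 0 + lcost 1))))"
      unfolding trivial_com_def
      by (intro exI conjI, (rule exec.Seq exec.Output)+) (simp_all add: output_tape_def input_state_def)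
    then show ?thesis using that by blast
  qed
  have "aval ?b ?s \<noteq> 0" using assms regs by simp
  from exec.CondTrue[OF this ts(1)] have ex: "exec reduction ?s (1 + acost ?b ?s + t) s"
    unfolding reduction_def .
  have "lcost n \<le> n + 1" "lcost k \<le> k + 1" "lcost 1 \<le> 2" "lcost 0 \<le> 1" "lcost 2 \<le> 3"
    using floorlog_le[OF less_exp[of n]] floorlog_le[OF less_exp[of k]] floorlog_le[of 1 1]
      floorlog_le[of 0 0] floorlog_le[of 2 2] by (simp_all add: lcost_def)
  moreover have "acost ?b ?s = lcost n + lcost k + lcost 1" using assms regs by simp
  ultimately have "1 + acost ?b ?s + t \<le> n + k + 30" unfolding ts(3) by linarith
  \<comment> \<open>Here \<open>k\<close> is not bounded by \<open>n\<close>, so the cost of reading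
    it must be absorbed by \<open>2 ^ k\<close>.\<close>
  also have "\<dots> \<le> n + 2 ^ k + 30" using less_exp[of k] by linarith
  also have "\<dots> \<le> 2 ^ k * (n + 50)"
  proof -
    have "n + 30 \<le> 2 ^ k * (n + 30)" by simp
    then show ?thesis by (simp add: algebra_simps)
  qed
  also have "\<dots> \<le> 2 ^ k * poly time_poly n" by (simp add: time_poly_def)
  finally show ?thesis using ex ts(2) by blast
qed

lemma no_clique_larger:
  assumes "n < k"
  shows "\<not> has_clique n E k"
proof
  assume "has_clique n E k"
  then obtain K where "K \<subseteq> {..<n}" "card K = k" unfolding has_clique_def by blast
  then show False using card_mono[of "{..<n}" K] assms by simp
qed

theorem theorem2:
  shows "\<exists>(c::nat) (prog::com) (p::nat poly). c > 0 \<and>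
    (\<forall>(n::nat) (E::(nat \<times> nat) set) (k::nat). simple_graph n E \<and> k > 0 \<longrightarrow>
      (\<exists>(t::nat) (s::state) (L::nat) (d::nat) (xs::bool list list).
        exec prog (input_state n E k) t s \<and>
        t \<le> 2 ^ k * poly p n \<and>
        tape s = output_tape L d xs \<and>
        (\<forall>x\<in>set xs. length x = L) \<and>
        (has_clique n E k \<longrightarrow>
          (\<exists>w::bool list. length w = L \<and> (\<forall>x\<in>set xs. Ham w x \<le> d))) \<and>
        (\<not> has_clique n E k \<longrightarrow>
          (\<forall>w::bool list. length w = L \<longrightarrow>
            (\<exists>x\<in>set xs. real (Ham w x) > (1 + 1 / (real c * real k)) * real d)))))"
proof (rule exI[of _ 24], rule exI[of _ reduction], rule exI[of _ time_poly], intro conjI allI impI)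
  fix n k :: nat and E assume "simple_graph n E \<and> k > 0"
  then have graph: "simple_graph n E" and k: "k > 0" by auto
  let ?thesis = "\<exists>t s L d xs.
        exec reduction (input_state n E k) t s \<and>
        t \<le> 2 ^ k * poly time_poly n \<and>
        tape s = output_tape L d xs \<and>
        (\<forall>x\<in>set xs. length x = L) \<and>
        (has_clique n E k \<longrightarrow>
          (\<exists>w::bool list. length w = L \<and> (\<forall>x\<in>set xs. Ham w x \<le> d))) \<and>
        (\<not> has_clique n E k \<longrightarrow>
          (\<forall>w::bool list. length w = L \<longrightarrow>
            (\<exists>x\<in>set xs. real (Ham w x) > (1 + 1 / (real 24 * real k)) * real d)))"
  show ?thesis
  proof (cases "n < k")
    case True
    then obtain t s where ts: "exec reduction (input_state n E k) t s" "t \<le> 2 ^ k * poly time_poly n"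
      "tape s = output_tape 1 0 [[False], [True]]"
      using reduction_exec_trivial by blast
    have "\<exists>x\<in>set [[False], [True]]. real (Ham w x) > 0" if "length w = 1" for w
    \<comment> \<open>With radius 0 any disagreement suffices, and the one-bit string opposite to
      \<open>w\<close> is in the family.\<close>
    proof (intro bexI[of _ "[\<not> hd w]"])
      have "Ham w [\<not> hd w] = 1"
        using that by (cases w) (auto simp: Ham_def conj_commute cong: conj_cong)
      then show "real (Ham w [\<not> hd w]) > 0" by simp
    qed auto
    then show ?thesis using ts no_clique_larger[OF True]
      by (intro exI[of _ t] exI[of _ s] exI[of _ 1] exI[of _ 0] exI[of _ "[[False], [True]]"]) simp
  next
    case False
    then interpret clique_instance n k E using graph k by unfold_locales auto
    obtain t s c where ts: "exec reduction (input_state n E k) t s" "t \<le> 2 ^ k * poly time_poly n"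
      and c: "is_code n m c" and tape: "tape s = output_tape (k * (16 * m)) d (test_strings E k m c)"
      using reduction_exec by blast
    have len: "\<forall>x\<in>set (test_strings E k m c). length x = k * (16 * m)"
      unfolding set_test_strings by (auto simp: test_string_def)
    have yes: "\<exists>w. length w = k * (16 * m) \<and> (\<forall>x\<in>set (test_strings E k m c). Ham w x \<le> d)"
      if "has_clique n E k"
      using completeness[OF c that] unfolding set_test_strings d_def by blast
    have no: "\<exists>x\<in>set (test_strings E k m c). real (Ham w x) > (1 + 1 / (real 24 * real k)) * real d"
      if nc: "\<not> has_clique n E k" and w: "length w = k * (16 * m)" for w
    proof -
      \<comment> \<open>The radius \<open>d = 8 * k * m + 15 * m\<close> is below
        \<open>24 * k * m\<close>, so \<open>d / (24 * k)\<close> is less than \<open>m\<close>, the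
        difference between the two distance bounds. This is the origin of the constant 24.\<close>
      have gap: "(1 + 1 / (real 24 * real k)) * real d < real (8 * k * m + 16 * m)"
      proof -
        have "real k \<ge> 1" "real m > 0" using k m_pos by auto
        then have "8 * (real k * real m) + 15 * real m < 24 * (real k * real m)"
          using mult_right_mono[of 1 "real k" "real m"] by linarith
        then show ?thesis using k by (simp add: d_def field_simps)
      qed
      obtain i j y z s' where "i < k" "j < k" "y < 2 ^ (16 * m)" "z < 2 ^ (16 * m)" "s' < 2 ^ k"
        "8 * k * m + 16 * m \<le> Ham w (test_string E k m c i j y z s')"
        using soundness[OF c graph k_pos k_le w] nc by (meson not_le)
      moreover from this have "(1 + 1 / (real 24 * real k)) * real d < real (Ham w (test_string E k m c i j y z s'))"
        using gap by linarith
      ultimately show ?thesis unfolding set_test_strings by blast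
    qed
    show ?thesis using ts tape len yes no by blast
  qed
qed simp

end
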